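(* Let $1<\gamma<3$, let $k$ satisfy (A1), and suppose there is $\delta\in(0,2)$ such that $$k'(x)\le \frac{k^2(x)}{(2-\delta)b}\qquad\text{for all }x\in I.$$ Suppose the data $S_0,R_0,S_B,R_B$ satisfy (A2)--(A5). Suppose moreover that for all $x\in I$: if $b\neq-1$, $$\frac{k(x)S_0(x)}{2}\Big(\frac{1}{-b}-\frac{1}{b+1}\xi_0(x)\Big)\le S_0'(x),\qquad \frac{k(x)S_0(x)}{2}\Big(\frac{1}{-b}-\frac{1}{b(b+1)}\xi_0(x)\Big)\le R_0'(x);$$ if $b=-1$, $$\frac{k(x)S_0(x)}{2}\big(1-\epsilon_0(x)\xi_0(x)\big)\le S_0'(x),\qquad \frac{k(x)S_0(x)}{2}\big(1+\xi_0(x)+\epsilon_0(x)\xi_0(x)\big)\le R_0'(x);$$ and that for all $t\in[0,\infty)$: if $b\ne-1$, $$S_B'(t)\le \frac{k(x_B)S_B^2(t)}{2}\Big(\frac1b+\frac{1}{b+1}\xi_B(t)+\frac{1-b}{2(b+1)(1-2b)}\xi_B^2(t)\Big),$$ $$R_B'(t)\le \frac{k(x_B)S_B^2(t)}{2}\Big(\frac1b+\frac{b+2}{b(b+1)}\xi_B(t)-\frac{b^2+3b-2}{2b(b+1)(1-2b)}\xi_B^2(t)\Big);$$ if $b=-1$, $$S_B'(t)\le \frac{k(x_B)S_B^2(t)}{2}\Big(-1+\epsilon_B(t)\xi_B(t)+\frac{2\epsilon_B(t)+1}{6}\xi_B^2(t)\Big),$$ $$R_B'(t)\le \frac{k(x_B)S_B^2(t)}{2}\Big(-1-(\epsilon_B(t)+2)\xi_B(t)-\frac{4\epsilon_B(t)+5}{6}\xi_B^2(t)\Big).$$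 Then there is $\nu_*>0$ such that for every $0<\nu\le\nu_*$ the global $C^1$ solution $(S,R)$ of problem (P) on $I\times[0,\infty)$, and the associated $v$ and $\rho$, satisfy: (i) for every fixed $x\in I$ with $k(x)>0$, the functions $t\mapsto S(x,t)$, $t\mapsto R(x,t)$, $t\mapsto v(x,t)$ decrease to $0$ as $t\to\infty$, and $\rho(x,t)\to0$ as $t\to\infty$; moreover $S(x,t)$, $R(x,t)$, $v(x,t)$ and $\rho(x,t)^{(\gamma-1)/2}$ are all $O(1/t)$ as $t\to\infty$; (ii) for every $x_*\in I$ with $k(x_* )>0$, all the convergences in (i) are uniform for $x\in[x_B,x_*]$.
   Context: Constants: $1<\gamma<3$ and $b:=-\frac{3-\gamma}{2(\gamma-1)}<0$ (so $b=-1$ iff $\gamma=5/3$). The interval $I$ is either $[x_B,x_C]$ or $[x_B,\infty)$, with interior $\mathring I$, and $k:I\to[0,\infty)$ is a given function (in applications $k=a'/a$ with $a$ the cross-sectional area of a duct). Problem (P): find $S(x,t),R(x,t)$ with $$S_t+\lambda_1S_x=g,\quad R_t+\lambda_2R_x=-g\quad (x\in\mathring I,\ t>0),$$ $$S(x,0)=S_0(x),\ R(x,0)=R_0(x)\ (x\in I),\qquad S(x_B,t)=S_B(t),\ R(x_B,t)=R_B(t)\ (t\ge0),$$ where $\lambda_1=\frac{\gamma+1}{4}S+\frac{3-\gamma}{4}R$, $\lambda_2=\frac{3-\gamma}{4}S+\frac{\gamma+1}{4}R$, $g=\frac{\gamma-1}{8}k(x)(R^2-S^2)$. The associated velocity and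 (rescaled) density are $v=\frac{S+R}{2}$ and $\rho=\left(\frac{\gamma-1}{16\nu}\right)^{\frac1{\gamma-1}}(R-S)^{\frac{2}{\gamma-1}}$. Under the hypotheses of the claim, problem (P) has a unique global $C^1$ solution for all sufficiently small $\nu$; this is the solution referred to. The data $S_0,R_0,S_B,R_B$ may depend on a small parameter $\nu>0$ (the functions $k$ and the constants $\gamma$, $b$ do not); all conditions on the data are assumed for each small $\nu$. A quantity is $O(\sqrt\nu)$ if it is bounded in absolute value by $C\sqrt\nu$ for small $\nu$ with $C$ independent of $\nu$, $x$, $t$. Notation: $\xi_0(x)=\frac{R_0(x)}{S_0(x)}-1$, $\xi_B(t)=\frac{R_B(t)}{S_B(t)}-1$, $\epsilon_0(x)=\ln(S_0(x)\xi_0(x))$, $\epsilon_B(t)=\ln(S_B(t)\xi_B(t))$. Conditions: (A1) $k\ge0$, $k\in C^1(I)$ with bounded $C^1$ norm. (A2) $S_0(x_B)=S_B(0)$, $R_0(x_B)=R_B(0)$, and $S_B'(0)+\big(\frac{\gamma+1}{4}S_0(x_B)+\frac{3-\gamma}{4}R_0(x_B)\big)S_0'(x_B)=\frac{\gamma-1}{8}k(x_B)\big(R_0^2(x_B)-S_0^2(x_B)\big)$, $R_B'(0)+\big(\frac{3-\gamma}{4}S_0(x_B)+\frac{\gamma+1}{4}R_0(x_B)\big)R_0'(x_B)=-\frac{\gamma-1}{8}k(x_B)\big(R_0^2(x_B)-S_0^2(x_B)\big)$. (A3) $S_0,R_0\in C^1(I)$ have bounded $C^1$ norms and $0<S_0(x)<R_0(x)$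 for all $x\in I$. (A4) $S_B,R_B\in C^1([0,\infty))$ have bounded $C^1$ norms and $0<S_B(t)<R_B(t)$ for all $t\ge0$. (A5) $S_0'(x)\ge0$, $R_0'(x)\ge0$, $\xi_0(x)=O(\sqrt\nu)$ for all $x\in I$; $S_B'(t)\le0$, $R_B'(t)\le0$, $\xi_B(t)=O(\sqrt\nu)$ for all $t\ge0$.
   Formalization: The C^1 norms of the data in (A3) and (A4) are assumed bounded uniformly in small ν; with bounds allowed to depend on ν the claim fails for b=-1 (S_0 of size exp(2/√ν) allows S_0'=0 where k>0, so S initially increases), while for b≠-1 the general case follows by scaling. *)

theory Defs
  imports "HOL-Analysis.Analysis" "HOL-Library.Landau_Symbols"
begin

section \<open>Derivatives on closed intervals\<close>

text \<open>At an endpoint of \<open>A\<close> this is the one-sided derivative, so values of \<open>f\<close> outside \<open>A\<close> are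
  irrelevant.\<close>

abbreviation deriv_in :: "real set \<Rightarrow> (real \<Rightarrow> real) \<Rightarrow> real \<Rightarrow> real" where
  "deriv_in A f x \<equiv> vector_derivative f (at x within A)"

definition C1_on :: "real set \<Rightarrow> (real \<Rightarrow> real) \<Rightarrow> bool" where
  "C1_on A f \<longleftrightarrow> f differentiable_on A \<and> continuous_on A (deriv_in A f)"

definition C1_norm_le :: "real set \<Rightarrow> (real \<Rightarrow> real) \<Rightarrow> real \<Rightarrow> bool" where
  "C1_norm_le A f M \<longleftrightarrow> C1_on A f \<and> (\<forall>x\<in>A. \<forall>y\<in>A. \<bar>f x\<bar> + \<bar>deriv_in A f y\<bar> \<le> M)"

text \<open>\<open>C\<^sup>1\<close> functions of \<open>(x, t)\<close> on a closed set \<open>D\<close>, up to and including its boundary.\<close>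

definition C1_on_xt :: "(real \<times> real) set \<Rightarrow> (real \<Rightarrow> real \<Rightarrow> real) \<Rightarrow> bool" where
  "C1_on_xt D F \<longleftrightarrow>
     (\<exists>Fx Ft. continuous_on D Fx \<and> continuous_on D Ft \<and>
        (\<forall>p\<in>D. ((\<lambda>(x, t). F x t) has_derivative (\<lambda>(h, s). Fx p * h + Ft p * s)) (at p within D)))"


section \<open>The initial-boundary value problem\<close>

definition b_const :: "real \<Rightarrow> real" where
  "b_const \<gamma> = - ((3 - \<gamma>) / (2 * (\<gamma> - 1)))"

definition lambda1 :: "real \<Rightarrow> real \<Rightarrow> real \<Rightarrow> real" where
  "lambda1 \<gamma> s r = (\<gamma> + 1) / 4 * s + (3 - \<gamma>) / 4 * r"

definition lambda2 :: "real \<Rightarrow> real \<Rightarrow> real \<Rightarrow> real" where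
  "lambda2 \<gamma> s r = (3 - \<gamma>) / 4 * s + (\<gamma> + 1) / 4 * r"

text \<open>The source term \<open>g\<close>; the argument \<open>\<kappa>\<close> is the value \<open>k x\<close>.\<close>

definition source :: "real \<Rightarrow> real \<Rightarrow> real \<Rightarrow> real \<Rightarrow> real" where
  "source \<gamma> \<kappa> s r = (\<gamma> - 1) / 8 * \<kappa> * (r\<^sup>2 - s\<^sup>2)"

definition global_C1_solution ::
  "real \<Rightarrow> real set \<Rightarrow> real \<Rightarrow> (real \<Rightarrow> real) \<Rightarrow>
   (real \<Rightarrow> real) \<Rightarrow> (real \<Rightarrow> real) \<Rightarrow> (real \<Rightarrow> real) \<Rightarrow> (real \<Rightarrow> real) \<Rightarrow>
   (real \<Rightarrow> real \<Rightarrow> real) \<Rightarrow> (real \<Rightarrow> real \<Rightarrow> real) \<Rightarrow> bool" where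
  "global_C1_solution \<gamma> I xB k S0 R0 SB RB S R \<longleftrightarrow>
     C1_on_xt (I \<times> {0..}) S \<and> C1_on_xt (I \<times> {0..}) R \<and>
     (\<forall>x\<in>interior I. \<forall>t>0.
        deriv (\<lambda>\<tau>. S x \<tau>) t + lambda1 \<gamma> (S x t) (R x t) * deriv (\<lambda>y. S y t) x
          = source \<gamma> (k x) (S x t) (R x t) \<and>
        deriv (\<lambda>\<tau>. R x \<tau>) t + lambda2 \<gamma> (S x t) (R x t) * deriv (\<lambda>y. R y t) x
          = - source \<gamma> (k x) (S x t) (R x t)) \<and>
     (\<forall>x\<in>I. S x 0 = S0 x \<and> R x 0 = R0 x) \<and>
     (\<forall>t\<ge>0. S xB t = SB t \<and> R xB t = RB t)"

definition velocity :: "real \<Rightarrow> real \<Rightarrow> real" where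
  "velocity s r = (s + r) / 2"

definition gas_density :: "real \<Rightarrow> real \<Rightarrow> real \<Rightarrow> real \<Rightarrow> real" where
  "gas_density \<gamma> \<nu> s r =
     ((\<gamma> - 1) / (16 * \<nu>)) powr (1 / (\<gamma> - 1)) * (r - s) powr (2 / (\<gamma> - 1))"


section \<open>Conditions on the coefficient and the data\<close>

text \<open>\<open>xi\<close> and \<open>eps\<close> give \<open>\<xi>\<^sub>0, \<epsilon>\<^sub>0\<close> for the initial data and \<open>\<xi>\<^sub>B, \<epsilon>\<^sub>B\<close> for the boundary data.\<close>

definition xi :: "(real \<Rightarrow> real) \<Rightarrow> (real \<Rightarrow> real) \<Rightarrow> real \<Rightarrow> real" where
  "xi s r y = r y / s y - 1"

definition eps :: "(real \<Rightarrow> real) \<Rightarrow> (real \<Rightarrow> real) \<Rightarrow> real \<Rightarrow> real" where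
  "eps s r y = ln (s y * xi s r y)"

definition cond_A1 :: "real set \<Rightarrow> (real \<Rightarrow> real) \<Rightarrow> bool" where
  "cond_A1 I k \<longleftrightarrow> (\<forall>x\<in>I. 0 \<le> k x) \<and> (\<exists>M. C1_norm_le I k M)"

definition cond_A2 ::
  "real \<Rightarrow> real set \<Rightarrow> real \<Rightarrow> (real \<Rightarrow> real) \<Rightarrow>
   (real \<Rightarrow> real) \<Rightarrow> (real \<Rightarrow> real) \<Rightarrow> (real \<Rightarrow> real) \<Rightarrow> (real \<Rightarrow> real) \<Rightarrow> bool" where
  "cond_A2 \<gamma> I xB k S0 R0 SB RB \<longleftrightarrow>
     S0 xB = SB 0 \<and> R0 xB = RB 0 \<and>
     deriv_in {0..} SB 0 + lambda1 \<gamma> (S0 xB) (R0 xB) * deriv_in I S0 xB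
       = source \<gamma> (k xB) (S0 xB) (R0 xB) \<and>
     deriv_in {0..} RB 0 + lambda2 \<gamma> (S0 xB) (R0 xB) * deriv_in I R0 xB
       = - source \<gamma> (k xB) (S0 xB) (R0 xB)"

text \<open>Regularity, bounds and ordering of a pair of data on \<open>A\<close>: \<open>A = I\<close> for the initial
  data, \<open>A = {0..}\<close> for the boundary data.  For data depending on \<open>\<nu>\<close>, "bounded \<open>C\<^sup>1\<close> norms" is a statement about
  the family: the bound \<open>M\<close> is independent of \<open>\<nu>\<close>, as is the constant in \<open>O(\<surd>\<nu>)\<close>.\<close>

definition cond_A34 :: "real set \<Rightarrow> real \<Rightarrow> (real \<Rightarrow> real) \<Rightarrow> (real \<Rightarrow> real) \<Rightarrow> bool" where
  "cond_A34 A M s r \<longleftrightarrow>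
     C1_norm_le A s M \<and> C1_norm_le A r M \<and> (\<forall>y\<in>A. 0 < s y \<and> s y < r y)"

text \<open>\<open>C\<close> is the constant in \<open>O(\<surd>\<nu>)\<close>.\<close>

definition cond_A5 ::
  "real set \<Rightarrow> real \<Rightarrow> real \<Rightarrow>
   (real \<Rightarrow> real) \<Rightarrow> (real \<Rightarrow> real) \<Rightarrow> (real \<Rightarrow> real) \<Rightarrow> (real \<Rightarrow> real) \<Rightarrow> bool" where
  "cond_A5 I C \<nu> S0 R0 SB RB \<longleftrightarrow>
     (\<forall>x\<in>I. 0 \<le> deriv_in I S0 x \<and> 0 \<le> deriv_in I R0 x \<and> \<bar>xi S0 R0 x\<bar> \<le> C * sqrt \<nu>) \<and>
     (\<forall>t\<ge>0. deriv_in {0..} SB t \<le> 0 \<and> deriv_in {0..} RB t \<le> 0 \<and> \<bar>xi SB RB t\<bar> \<le> C * sqrt \<nu>)"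

definition cond_initial ::
  "real \<Rightarrow> real set \<Rightarrow> (real \<Rightarrow> real) \<Rightarrow> (real \<Rightarrow> real) \<Rightarrow> (real \<Rightarrow> real) \<Rightarrow> bool" where
  "cond_initial \<gamma> I k S0 R0 \<longleftrightarrow>
     (let b = b_const \<gamma>; \<xi> = xi S0 R0; \<epsilon> = eps S0 R0 in
      \<forall>x\<in>I.
        (b \<noteq> -1 \<longrightarrow>
           k x * S0 x / 2 * (1 / (- b) - 1 / (b + 1) * \<xi> x) \<le> deriv_in I S0 x \<and>
           k x * S0 x / 2 * (1 / (- b) - 1 / (b * (b + 1)) * \<xi> x) \<le> deriv_in I R0 x) \<and>
        (b = -1 \<longrightarrow>
           k x * S0 x / 2 * (1 - \<epsilon> x * \<xi> x) \<le> deriv_in I S0 x \<and>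
           k x * S0 x / 2 * (1 + \<xi> x + \<epsilon> x * \<xi> x) \<le> deriv_in I R0 x))"

definition cond_boundary ::
  "real \<Rightarrow> real \<Rightarrow> (real \<Rightarrow> real) \<Rightarrow> (real \<Rightarrow> real) \<Rightarrow> (real \<Rightarrow> real) \<Rightarrow> bool" where
  "cond_boundary \<gamma> xB k SB RB \<longleftrightarrow>
     (let b = b_const \<gamma>; \<xi> = xi SB RB; \<epsilon> = eps SB RB in
      \<forall>t\<ge>0.
        (b \<noteq> -1 \<longrightarrow>
           deriv_in {0..} SB t \<le>
             k xB * (SB t)\<^sup>2 / 2 *
               (1 / b + 1 / (b + 1) * \<xi> t
                + (1 - b) / (2 * (b + 1) * (1 - 2 * b)) * (\<xi> t)\<^sup>2) \<and>
           deriv_in {0..} RB t \<le>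
             k xB * (SB t)\<^sup>2 / 2 *
               (1 / b + (b + 2) / (b * (b + 1)) * \<xi> t
                - (b\<^sup>2 + 3 * b - 2) / (2 * b * (b + 1) * (1 - 2 * b)) * (\<xi> t)\<^sup>2)) \<and>
        (b = -1 \<longrightarrow>
           deriv_in {0..} SB t \<le>
             k xB * (SB t)\<^sup>2 / 2 *
               (-1 + \<epsilon> t * \<xi> t + (2 * \<epsilon> t + 1) / 6 * (\<xi> t)\<^sup>2) \<and>
           deriv_in {0..} RB t \<le>
             k xB * (SB t)\<^sup>2 / 2 *
               (-1 - (\<epsilon> t + 2) * \<xi> t - (4 * \<epsilon> t + 5) / 6 * (\<xi> t)\<^sup>2)))"

end

theory Submission
  imports Defs
begin

text \<open>
  Why the solution decays.  Along its own characteristics \<open>S\<close> grows, and both families of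
  characteristics run to the right, so \<open>S\<close> can only decay because ever smaller boundary values are
  carried into the duct.  The mechanism is a lower bound
  \<open>- S\<^sub>t \<ge> a k S\<^sup>2\<close> with \<open>a = (\<gamma> - 1) / (2 (3 - \<gamma>)) = - 1 / (4 b)\<close>.
  At a fixed \<open>x\<close> with \<open>k x > 0\<close> it says that \<open>1 / S\<close> increases at rate at least \<open>a k x\<close>, hence
  \<open>S \<le> 1 / (a k t)\<close>.  The gap \<open>R - S\<close> stays below \<open>S\<close>, so \<open>R\<close>, the velocity and the right power of
  the density decay at the same rate; and \<open>k\<close> is nonincreasing, so the bound at \<open>x\<^sub>*\<close> serves the whole
  of \<open>[x\<^sub>B, x\<^sub>*]\<close>.

  The bound on \<open>S\<^sub>t\<close>.  Put \<open>P = - S\<^sub>t\<close>, \<open>Q = - R\<^sub>t\<close>.  Differentiating the equations in time and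
  eliminating \<open>S\<^sub>x\<close>, \<open>R\<^sub>x\<close> gives a system along the two families of characteristics for the pair
  \<open>(P - a k S\<^sup>2, Q)\<close> that is cooperative: each rate is at least a bounded multiple of its own unknown
  plus a nonnegative multiple of the other one
  (\<open>S_cooperative_inequality\<close>, \<open>R_cooperative_inequality\<close>).  This holds as soon as
  \<open>0 \<le> R - S \<le> e S\<close> for a small constant \<open>e\<close>.  The data conditions imply that to leading order
  \<open>P \<ge> 2 a k S\<^sup>2\<close> at \<open>t = 0\<close> and at \<open>x = x\<^sub>B\<close>, which leaves a factor two for all terms of order
  \<open>\<xi>\<close>; the condition on \<open>k'\<close> keeps the inhomogeneous term nonnegative.  In the resonant case
  \<open>b = -1\<close> the logarithm \<open>\<epsilon>\<close> is nonpositive for small \<open>\<nu>\<close>, so in the conditions on \<open>S\<^sub>0\<close> and \<open>S\<^sub>B\<close> the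
  logarithmic terms have the favourable sign.  Working with time
  derivatives has the advantage that \<open>Q \<ge> 0\<close> follows on both inflow sides from the monotonicity of
  the data alone, whereas \<open>R\<^sub>x\<close> may be slightly negative at \<open>x = x\<^sub>B\<close>.

  Nonnegativity of a cooperative pair is preserved by a minimum principle on rectangles
  (\<open>cooperative_min_principle\<close>): since both speeds are nonnegative, at a negative minimum away from the
  inflow sides \<open>x = x\<^sub>B\<close> and \<open>t = 0\<close> both left derivatives are nonpositive, which contradicts the
  inequalities after damping by \<open>exp (- \<kappa> t)\<close>.  This replaces an integration along characteristics.
  The solution being only \<open>C\<^sup>1\<close>, \<open>P\<close> and \<open>Q\<close> need not be differentiable; but their time difference
  quotients are \<open>C\<^sup>1\<close>, converge uniformly, and satisfy an exact discrete analogue of the differentiated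
  equations, so the principle is formulated for uniform limits.

  The region \<open>0 < S\<close>, \<open>0 < R - S < e S\<close> is never left (\<open>gap_invariant\<close>).  Up to the first time of
  contact with its boundary, the signs above hold, and then the minimum principle, applied to
  \<open>S\<close>, to \<open>R - S\<close> and to \<open>(e / 2) S - (R - S)\<close>, shows that the solution is still strictly inside.
\<close>

section \<open>Functions of two variables and their partial derivatives\<close>

text \<open>The partial derivatives are explicit arguments, not obtained by differentiation, since on the boundary
of a closed region they are limits of interior values and their continuity is what matters.\<close>

definition has_partials ::
  "(real \<times> real) set \<Rightarrow> (real \<times> real \<Rightarrow> real) \<Rightarrow> (real \<times> real \<Rightarrow> real) \<Rightarrow> (real \<times> real \<Rightarrow> real) \<Rightarrow> bool"
  where "has_partials A f fx ft \<longleftrightarrow>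
    (\<forall>p\<in>A. (f has_derivative (\<lambda>v. fx p * fst v + ft p * snd v)) (at p within A))"

lemma has_partials_subset: "has_partials A f fx ft \<Longrightarrow> B \<subseteq> A \<Longrightarrow> has_partials B f fx ft"
  unfolding has_partials_def by (meson has_derivative_subset subsetD)

lemma has_partials_continuous_on: "has_partials A f fx ft \<Longrightarrow> continuous_on A f"
  unfolding has_partials_def
  by (meson continuous_on_eq_continuous_within has_derivative_continuous)

lemma has_partials_D1:
  assumes "has_partials A f fx ft" "(x, t) \<in> A" "\<And>y. y \<in> J \<Longrightarrow> (y, t) \<in> A"
  shows "((\<lambda>y. f (y, t)) has_real_derivative fx (x, t)) (at x within J)"
proof -
  have "(f has_derivative (\<lambda>v. fx (x, t) * fst v + ft (x, t) * snd v)) (at (x, t) within A)"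
    using assms unfolding has_partials_def by blast
  then have "(f has_derivative (\<lambda>v. fx (x, t) * fst v + ft (x, t) * snd v))
      (at (x, t) within (\<lambda>y. (y, t)) ` J)"
    by (rule has_derivative_subset) (use assms in auto)
  moreover have "((\<lambda>y. (y, t)) has_derivative (\<lambda>h. (h, 0))) (at x within J)"
    by (auto intro!: derivative_eq_intros)
  ultimately have "((\<lambda>y. f (y, t)) has_derivative (\<lambda>h. fx (x, t) * h)) (at x within J)"
    using has_derivative_in_compose[of "\<lambda>y. (y, t)" "\<lambda>h. (h, 0)" x J f] by fastforce
  then show ?thesis
    by (simp add: has_field_derivative_def)
qed

lemma has_partials_D2:
  assumes "has_partials A f fx ft" "(x, t) \<in> A" "\<And>s. s \<in> J \<Longrightarrow> (x, s) \<in> A"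
  shows "((\<lambda>s. f (x, s)) has_real_derivative ft (x, t)) (at t within J)"
proof -
  have "(f has_derivative (\<lambda>v. fx (x, t) * fst v + ft (x, t) * snd v)) (at (x, t) within A)"
    using assms unfolding has_partials_def by blast
  then have "(f has_derivative (\<lambda>v. fx (x, t) * fst v + ft (x, t) * snd v))
      (at (x, t) within (\<lambda>s. (x, s)) ` J)"
    by (rule has_derivative_subset) (use assms in auto)
  moreover have "((\<lambda>s. (x, s)) has_derivative (\<lambda>h. (0, h))) (at t within J)"
    by (auto intro!: derivative_eq_intros)
  ultimately have "((\<lambda>s. f (x, s)) has_derivative (\<lambda>h. ft (x, t) * h)) (at t within J)"
    using has_derivative_in_compose[of "\<lambda>s. (x, s)" "\<lambda>h. (0, h)" t J f] by fastforce
  then show ?thesis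
    by (simp add: has_field_derivative_def)
qed

lemma left_derivative_nonpos_at_min:
  fixes f :: "real \<Rightarrow> real"
  assumes "(f has_real_derivative d) (at x within {l..u})" "l < x" "x \<le> u"
    and min: "\<And>y. l \<le> y \<Longrightarrow> y \<le> u \<Longrightarrow> f x \<le> f y"
  shows "d \<le> 0"
proof (rule ccontr)
  assume "\<not> d \<le> 0"
  then obtain r where r: "r > 0" "\<And>h. h > 0 \<Longrightarrow> x - h \<in> {l..u} \<Longrightarrow> h < r \<Longrightarrow> f (x - h) < f x"
    using has_real_derivative_pos_inc_left[OF assms(1)] by auto
  define h where "h = min (r / 2) (x - l)"
  have "h > 0" "h < r" "h \<le> x - l" using r(1) assms by (auto simp: h_def)
  moreover have "f x \<le> f (x - h)"
    by (rule min) (use \<open>0 < h\<close> \<open>h \<le> x - l\<close> \<open>x \<le> u\<close> in auto)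
  moreover have "x - h \<in> {l..u}" using \<open>0 < h\<close> \<open>h \<le> x - l\<close> \<open>x \<le> u\<close> by auto
  ultimately show False using r(2)[of h] by linarith
qed

text \<open>Only the derivatives to the left and to the past are used, so the minimum may lie on the sides
\<open>x = X\<close> or \<open>t = T\<close>.\<close>

lemma partials_nonpos_at_min:
  assumes f: "has_partials ({l..X} \<times> {0..T}) f fx ft"
    and p: "p \<in> {l..X} \<times> {0..T}" "l < fst p" "0 < snd p"
    and min: "\<And>q. q \<in> {l..X} \<times> {0..T} \<Longrightarrow> f p \<le> f q"
  shows "fx p \<le> 0" "ft p \<le> 0"
proof -
  obtain x t where xt: "p = (x, t)" by fastforce
  have "((\<lambda>y. f (y, t)) has_real_derivative fx (x, t)) (at x within {l..X})"
    by (rule has_partials_D1[OF f]) (use p xt in auto)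
  then show "fx p \<le> 0"
    using left_derivative_nonpos_at_min[of "\<lambda>y. f (y, t)" "fx (x, t)" x l X] p min xt by auto
  have "((\<lambda>s. f (x, s)) has_real_derivative ft (x, t)) (at t within {0..T})"
    by (rule has_partials_D2[OF f]) (use p xt in auto)
  then show "ft p \<le> 0"
    using left_derivative_nonpos_at_min[of "\<lambda>s. f (x, s)" "ft (x, t)" t 0 T] p min xt by auto
qed

section \<open>A minimum principle for cooperative transport inequalities\<close>

text \<open>The step of the minimum principle at the point where the smaller of the two damped functions
is minimal.  There the damped derivatives are nonpositive, while \<open>V \<ge> U\<close> and \<open>d \<ge> 0\<close> let the coupling
term be estimated by \<open>d U\<close>; the damping rate \<open>2 L + 1\<close> exceeds \<open>c + d\<close> by at least one, which bounds
\<open>- U\<close> by the total approximation error.\<close>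

lemma cooperative_scaled_min_ge:
  fixes U V Y Z c d \<mu> :: "real \<times> real \<Rightarrow> real"
  assumes U: "has_partials ({l..X} \<times> {0..T}) U Ux Ut"
    and p: "p \<in> {l..X} \<times> {0..T}"
    and min: "\<And>q. q \<in> {l..X} \<times> {0..T} \<Longrightarrow> exp (- (2 * L + 1) * snd p) * U p \<le> exp (- (2 * L + 1) * snd q) * U q"
    and UV: "U p \<le> V p"
    and close: "\<bar>U p - Y p\<bar> \<le> \<epsilon>" "\<bar>V p - Z p\<bar> \<le> \<epsilon>"
    and \<mu>: "0 \<le> \<mu> p" and c: "\<bar>c p\<bar> \<le> L" and d: "0 \<le> d p" "d p \<le> L"
    and ineq: "c p * Y p + d p * Z p - \<epsilon> \<le> Ut p + \<mu> p * Ux p"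
    and bdry: "fst p = l \<or> snd p = 0 \<Longrightarrow> 0 \<le> Y p"
  shows "- (2 * L + 1) * \<epsilon> \<le> U p"
proof (rule ccontr)
  assume neg: "\<not> ?thesis"
  let ?K = "{l..X} \<times> {0..T}" and ?\<kappa> = "2 * L + 1"
  have L: "0 \<le> L" and \<epsilon>: "0 \<le> \<epsilon>" using c close by auto
  have "\<epsilon> \<le> ?\<kappa> * \<epsilon>" using L \<epsilon> by (simp add: mult_le_cancel_right1)
  then have "\<not> (fst p = l \<or> snd p = 0)"
    using bdry neg close(1) by (auto simp: algebra_simps)
  then have off: "l < fst p" "0 < snd p"
    using p by (auto simp: mem_Times_iff)
  define E where "E q = exp (- ?\<kappa> * snd q)" for q :: "real \<times> real"
  have "has_partials ?K (\<lambda>q. E q * U q) (\<lambda>q. E q * Ux q) (\<lambda>q. E q * (Ut q - ?\<kappa> * U q))"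
    using U unfolding has_partials_def E_def
    by (auto intro!: derivative_eq_intros simp: algebra_simps fun_eq_iff)
  from partials_nonpos_at_min[OF this p off] min
  have "E p * Ux p \<le> 0" "E p * (Ut p - ?\<kappa> * U p) \<le> 0" by (auto simp: E_def)
  moreover have "E p > 0" by (simp add: E_def)
  ultimately have "Ux p \<le> 0" "Ut p \<le> ?\<kappa> * U p" by (auto simp: mult_le_0_iff)
  then have 1: "c p * Y p + d p * Z p - \<epsilon> \<le> ?\<kappa> * U p"
    using ineq mult_nonneg_nonpos[OF \<mu>, of "Ux p"] by linarith
  have "\<bar>c p * (Y p - U p)\<bar> \<le> L * \<epsilon>"
    unfolding abs_mult by (rule mult_mono) (use c close L in auto)
  moreover have "d p * (Z p - U p) \<ge> - (L * \<epsilon>)"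
  proof -
    have "d p * (Z p - U p) \<ge> d p * (- \<epsilon>)" by (rule mult_left_mono) (use d UV close in auto)
    moreover have "d p * \<epsilon> \<le> L * \<epsilon>" using d \<epsilon> by (rule_tac mult_right_mono)
    ultimately show ?thesis by simp
  qed
  ultimately have "(c p + d p) * U p - (2 * L + 1) * \<epsilon> \<le> ?\<kappa> * U p"
    using 1 by (simp add: algebra_simps abs_le_iff)
  then have "(?\<kappa> - c p - d p) * (- U p) \<le> ?\<kappa> * \<epsilon>" by (simp add: algebra_simps)
  moreover have "1 * (- U p) \<le> (?\<kappa> - c p - d p) * (- U p)"
  proof (rule mult_right_mono)
    show "1 \<le> ?\<kappa> - c p - d p" using c d by linarith
    have "0 \<le> ?\<kappa> * \<epsilon>" using L \<epsilon> by simp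
    then show "0 \<le> - U p" using neg by linarith
  qed
  ultimately show False using neg by linarith
qed

text \<open>A weak minimum principle: \<open>Y\<close> and \<open>Z\<close> need not be differentiable, it suffices that they are uniform
limits of functions that satisfy the transport inequalities up to a vanishing error.  No boundary
condition is imposed at \<open>x = X\<close>, because the speeds \<open>\<mu>1, \<mu>2\<close> are nonnegative.\<close>

lemma cooperative_min_principle:
  fixes Y Z c1 c2 d1 d2 \<mu>1 \<mu>2 :: "real \<times> real \<Rightarrow> real"
  defines "K \<equiv> \<lambda>l X T. {l..X} \<times> {0..T::real}"
  assumes approx: "\<And>\<epsilon>. \<epsilon> > 0 \<Longrightarrow> \<exists>U Ux Ut V Vx Vt.
      has_partials (K l X T) U Ux Ut \<and> has_partials (K l X T) V Vx Vt \<and>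
      (\<forall>p\<in>K l X T. \<bar>U p - Y p\<bar> \<le> \<epsilon> \<and> \<bar>V p - Z p\<bar> \<le> \<epsilon> \<and>
         c1 p * Y p + d1 p * Z p - \<epsilon> \<le> Ut p + \<mu>1 p * Ux p \<and>
         c2 p * Z p + d2 p * Y p - \<epsilon> \<le> Vt p + \<mu>2 p * Vx p)"
    and coeff: "\<And>p. p \<in> K l X T \<Longrightarrow> 0 \<le> \<mu>1 p \<and> 0 \<le> \<mu>2 p \<and> \<bar>c1 p\<bar> \<le> L \<and> \<bar>c2 p\<bar> \<le> L \<and>
         0 \<le> d1 p \<and> d1 p \<le> L \<and> 0 \<le> d2 p \<and> d2 p \<le> L"
    and bdry: "\<And>p. p \<in> K l X T \<Longrightarrow> fst p = l \<or> snd p = 0 \<Longrightarrow> 0 \<le> Y p \<and> 0 \<le> Z p"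
    and p: "p \<in> K l X T"
  shows "0 \<le> Y p \<and> 0 \<le> Z p"
proof (rule ccontr)
  assume "\<not> ?thesis"
  then have neg: "min (Y p) (Z p) < 0" by auto
  define \<eta> where "\<eta> = - min (Y p) (Z p)"
  have \<eta>: "\<eta> > 0" using neg by (simp add: \<eta>_def)
  let ?\<kappa> = "2 * L + 1" and ?K = "K l X T"
  have L: "0 \<le> L" using coeff[OF p] by auto
  have T: "0 \<le> snd p" "snd p \<le> T" using p by (auto simp: K_def)
  \<comment> \<open>The damped functions drop to at most \<open>- exp (- \<kappa> T) \<eta> / 2\<close>, while errors of size \<open>\<epsilon>\<close> can only account
      for a minimum of \<open>- \<kappa> \<epsilon>\<close>; this choice makes the latter half as large.\<close>
  define \<epsilon> where "\<epsilon> = exp (- ?\<kappa> * T) * \<eta> / (4 * ?\<kappa>)"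
  have \<epsilon>: "\<epsilon> > 0" using \<eta> L by (simp add: \<epsilon>_def)
  have "?\<kappa> \<noteq> 0" using L by linarith
  then have \<epsilon>1: "?\<kappa> * \<epsilon> = exp (- ?\<kappa> * T) * \<eta> / 4" unfolding \<epsilon>_def by (metis nonzero_mult_divide_mult_cancel_right times_divide_eq_right mult.commute)
  have "\<epsilon> \<le> \<eta> / 2"
  proof -
    have "\<epsilon> \<le> ?\<kappa> * \<epsilon>" using L \<epsilon> by (simp add: mult_le_cancel_right1)
    also have "\<dots> \<le> 1 * \<eta> / 4"
      unfolding \<epsilon>1 using \<eta> L T
      by (intro divide_right_mono mult_right_mono) (auto intro: mult_nonpos_nonneg)
    finally show ?thesis using \<eta> by simp
  qed
  obtain U Ux Ut V Vx Vt where U: "has_partials ?K U Ux Ut" and V: "has_partials ?K V Vx Vt"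
    and UV: "\<And>p. p \<in> ?K \<Longrightarrow> \<bar>U p - Y p\<bar> \<le> \<epsilon> \<and> \<bar>V p - Z p\<bar> \<le> \<epsilon> \<and>
         c1 p * Y p + d1 p * Z p - \<epsilon> \<le> Ut p + \<mu>1 p * Ux p \<and>
         c2 p * Z p + d2 p * Y p - \<epsilon> \<le> Vt p + \<mu>2 p * Vx p"
    using approx[OF \<epsilon>] by blast
  define E where "E q = exp (- ?\<kappa> * snd q)" for q :: "real \<times> real"
  have E: "E q > 0" for q by (simp add: E_def)
  define f where "f q = min (E q * U q) (E q * V q)" for q
  have "continuous_on ?K f"
    unfolding f_def E_def
    by (intro continuous_intros has_partials_continuous_on[OF U] has_partials_continuous_on[OF V])
  moreover have "compact ?K" by (simp add: K_def compact_Times)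
  ultimately obtain q where q: "q \<in> ?K" "\<And>r. r \<in> ?K \<Longrightarrow> f q \<le> f r"
    using continuous_attains_inf[of ?K f] p by blast
  have fE: "f r = E r * min (U r) (V r)" for r
    using E[of r] by (simp add: f_def min_mult_distrib_left)
  have low: "- ?\<kappa> * \<epsilon> \<le> min (U q) (V q)"
  proof (cases "U q \<le> V q")
    case True
    then have "f q = E q * U q" by (simp add: fE)
    then have "E q * U q \<le> E r * U r" if "r \<in> ?K" for r
      using q(2)[OF that] by (simp add: f_def)
    then show ?thesis
      using cooperative_scaled_min_ge[of l X T U Ux Ut q L V Y \<epsilon> Z \<mu>1 c1 d1]
        U UV[OF q(1)] coeff[OF q(1)] bdry[OF q(1)] q(1) True
      by (auto simp: E_def K_def)
  next
    case False
    then have "f q = E q * V q" by (simp add: fE)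
    then have "E q * V q \<le> E r * V r" if "r \<in> ?K" for r
      using q(2)[OF that] by (simp add: f_def)
    then show ?thesis
      using cooperative_scaled_min_ge[of l X T V Vx Vt q L U Z \<epsilon> Y \<mu>2 c2 d2]
        V UV[OF q(1)] coeff[OF q(1)] bdry[OF q(1)] q(1) False
      by (auto simp: E_def K_def)
  qed
  have "- (?\<kappa> * \<epsilon>) \<le> f q"
  proof -
    have "E q \<le> 1" using q(1) L by (auto simp: E_def K_def intro: mult_nonpos_nonneg)
    then have "E q * (?\<kappa> * \<epsilon>) \<le> 1 * (?\<kappa> * \<epsilon>)" using L \<epsilon> by (intro mult_right_mono) auto
    moreover have "E q * (- ?\<kappa> * \<epsilon>) \<le> f q"
      unfolding fE by (rule mult_left_mono[OF low]) (use E[of q] in auto)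
    moreover have "E q * (- ?\<kappa> * \<epsilon>) = - (E q * (?\<kappa> * \<epsilon>))" by (simp add: algebra_simps)
    ultimately show ?thesis by linarith
  qed
  also have "f q \<le> f p" using q p by blast
  also have "f p \<le> exp (- ?\<kappa> * T) * (- \<eta> / 2)"
  proof -
    have "min (U p) (V p) \<le> - \<eta> / 2" using UV[OF p] \<open>\<epsilon> \<le> \<eta> / 2\<close> by (auto simp: \<eta>_def min_def split: if_splits)
    then have "f p \<le> E p * (- \<eta> / 2)" unfolding fE by (rule mult_left_mono) (use E[of p] in auto)
    also have "\<dots> \<le> exp (- ?\<kappa> * T) * (- \<eta> / 2)"
      by (rule mult_right_mono_neg) (use \<eta> T L in \<open>auto simp: E_def mult_left_mono\<close>)
    finally show ?thesis .
  qed
  finally show False using \<epsilon>1 \<eta> by simp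
qed

text \<open>The special case of one classical function, that is, of two equal ones without coupling.\<close>

lemma transport_min_principle:
  assumes u: "has_partials ({l..X} \<times> {0..T}) u ux ut"
    and ineq: "\<And>p. p \<in> {l..X} \<times> {0..T} \<Longrightarrow> 0 \<le> \<mu> p \<and> \<bar>c p\<bar> \<le> L \<and> c p * u p \<le> ut p + \<mu> p * ux p"
    and bdry: "\<And>p. p \<in> {l..X} \<times> {0..T} \<Longrightarrow> fst p = l \<or> snd p = 0 \<Longrightarrow> 0 \<le> u p"
    and p: "p \<in> {l..X} \<times> {0..T}"
  shows "0 \<le> u p"
proof -
  have "0 \<le> L" using ineq[OF p] by auto
  have "0 \<le> u p \<and> 0 \<le> u p"
  proof (rule cooperative_min_principle[of l X T u u c "\<lambda>_. 0" \<mu> c "\<lambda>_. 0" \<mu> L p])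
    fix \<epsilon> :: real assume "\<epsilon> > 0"
    have *: "c p * u p + 0 * u p - \<epsilon> \<le> ut p + \<mu> p * ux p" if "p \<in> {l..X} \<times> {0..T}" for p
      using ineq[OF that] \<open>\<epsilon> > 0\<close> by linarith
    show "\<exists>U Ux Ut V Vx Vt.
      has_partials ({l..X} \<times> {0..T}) U Ux Ut \<and> has_partials ({l..X} \<times> {0..T}) V Vx Vt \<and>
      (\<forall>p\<in>{l..X} \<times> {0..T}. \<bar>U p - u p\<bar> \<le> \<epsilon> \<and> \<bar>V p - u p\<bar> \<le> \<epsilon> \<and>
         c p * u p + 0 * u p - \<epsilon> \<le> Ut p + \<mu> p * Ux p \<and>
         c p * u p + 0 * u p - \<epsilon> \<le> Vt p + \<mu> p * Vx p)"
      using \<open>\<epsilon> > 0\<close>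
      by (intro exI[of _ u] exI[of _ ux] exI[of _ ut] conjI ballI u *) auto
  qed (use ineq bdry p \<open>0 \<le> L\<close> in auto)
  then show ?thesis by simp
qed

section \<open>Uniform convergence of time difference quotients\<close>

lemma uniform_limit_mult_continuous:
  fixes f g :: "'a \<Rightarrow> 'b::topological_space \<Rightarrow> real"
  assumes "uniform_limit K f F net" "uniform_limit K g G net"
    and "compact K" "continuous_on K F" "continuous_on K G"
  shows "uniform_limit K (\<lambda>h p. f h p * g h p) (\<lambda>p. F p * G p) net"
  using assms by (intro uniform_lim_mult compact_imp_bounded compact_continuous_image)

lemma uniform_limit_time_shift:
  fixes f :: "real \<times> real \<Rightarrow> real"
  assumes "continuous_on ({l..X} \<times> {0..T + 1}) f"
  shows "uniform_limit ({l..X} \<times> {0..T}) (\<lambda>h p. f (fst p, snd p + h)) f (at_right (0::real))"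
  unfolding uniform_limit_iff
proof (intro allI impI)
  fix \<epsilon> :: real assume "\<epsilon> > 0"
  have "uniformly_continuous_on ({l..X} \<times> {0..T + 1}) f"
    by (rule compact_uniformly_continuous[OF assms]) (intro compact_Times compact_Icc)
  then obtain d where d: "d > 0" "\<And>p q. p \<in> {l..X} \<times> {0..T + 1} \<Longrightarrow>
      q \<in> {l..X} \<times> {0..T + 1} \<Longrightarrow> dist q p < d \<Longrightarrow> dist (f q) (f p) < \<epsilon>"
    unfolding uniformly_continuous_on_def using \<open>\<epsilon> > 0\<close> by metis
  have "eventually (\<lambda>h. h \<in> {0<..<min 1 d}) (at_right (0::real))"
    by (rule eventually_at_right_real) (use d in auto)
  then show "\<forall>\<^sub>F h in at_right 0. \<forall>p\<in>{l..X} \<times> {0..T}. dist (f (fst p, snd p + h)) (f p) < \<epsilon>"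
  proof eventually_elim
    case (elim h)
    show ?case
    proof
      fix p assume p: "p \<in> {l..X} \<times> {0..T}"
      have "dist (fst p, snd p + h) p < d"
        using elim by (cases p) (simp add: dist_Pair_Pair dist_real_def)
      then show "dist (f (fst p, snd p + h)) (f p) < \<epsilon>"
        by (intro d(2)) (use p elim in auto)
    qed
  qed
qed

text \<open>By the mean value theorem the quotient is a value of \<open>ft\<close> at a nearby time, and \<open>ft\<close> is uniformly
continuous on the rectangle.\<close>

lemma uniform_limit_time_difference_quotient:
  assumes f: "has_partials ({l..X} \<times> {0..T + 1}) f fx ft"
    and cont: "continuous_on ({l..X} \<times> {0..T + 1}) ft"
  shows "uniform_limit ({l..X} \<times> {0..T}) (\<lambda>h p. (f (fst p, snd p + h) - f p) / h) ft (at_right (0::real))"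
  unfolding uniform_limit_iff
proof (intro allI impI)
  fix \<epsilon> :: real assume "\<epsilon> > 0"
  have "uniformly_continuous_on ({l..X} \<times> {0..T + 1}) ft"
    by (rule compact_uniformly_continuous[OF cont]) (intro compact_Times compact_Icc)
  then obtain d where d: "d > 0" "\<And>p q. p \<in> {l..X} \<times> {0..T + 1} \<Longrightarrow>
      q \<in> {l..X} \<times> {0..T + 1} \<Longrightarrow> dist q p < d \<Longrightarrow> dist (ft q) (ft p) < \<epsilon>"
    unfolding uniformly_continuous_on_def using \<open>\<epsilon> > 0\<close> by metis
  have "eventually (\<lambda>h. h \<in> {0<..<min 1 d}) (at_right (0::real))"
    by (rule eventually_at_right_real) (use d in auto)
  then show "\<forall>\<^sub>F h in at_right 0. \<forall>p\<in>{l..X} \<times> {0..T}. dist ((f (fst p, snd p + h) - f p) / h) (ft p) < \<epsilon>"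
  proof eventually_elim
    case (elim h)
    show ?case
    proof
      fix p assume p: "p \<in> {l..X} \<times> {0..T}"
      obtain x t where xt: "p = (x, t)" by fastforce
      have "\<exists>s\<in>{t<..<t + h}. f (x, t + h) - f (x, t) = ft (x, s) * (t + h - t)"
      proof (rule mvt_simple)
        fix s assume s: "t \<le> s" "s \<le> t + h"
        show "((\<lambda>s. f (x, s)) has_derivative (*) (ft (x, s))) (at s within {t..t + h})"
          unfolding has_field_derivative_def[symmetric]
          by (rule has_partials_D2[OF f]) (use s p xt elim in auto)
      qed (use elim in auto)
      then obtain s where s: "s \<in> {t<..<t + h}" "f (x, t + h) - f (x, t) = ft (x, s) * h" by auto
      have "dist (x, s) (x, t) < d"
        using elim s by (simp add: dist_Pair_Pair dist_real_def)
      then have "dist (ft (x, s)) (ft p) < \<epsilon>"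
        unfolding xt by (intro d(2)) (use p s xt elim in auto)
      then show "dist ((f (fst p, snd p + h) - f p) / h) (ft p) < \<epsilon>"
        using s elim by (simp add: xt)
    qed
  qed
qed

lemma continuous_on_compact_bounded_abs:
  fixes f :: "'a::topological_space \<Rightarrow> real"
  assumes "compact K" "continuous_on K f"
  obtains L where "\<And>p. p \<in> K \<Longrightarrow> \<bar>f p\<bar> \<le> L"
  using compact_imp_bounded[OF compact_continuous_image[OF assms(2,1)]]
  unfolding bounded_iff by auto

section \<open>Elementary estimates for the speeds and the source\<close>

text \<open>The coefficients of \<open>lambda1\<close> are positive and add up to one, so the speed lies between \<open>s\<close> and \<open>r\<close>;
the same holds for \<open>lambda2\<close>.\<close>

lemma lambda1_ge:
  assumes "1 < \<gamma>" "\<gamma> < 3" "s \<le> r"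
  shows "s \<le> lambda1 \<gamma> s r"
proof -
  have "lambda1 \<gamma> s r - s = (3 - \<gamma>) / 4 * (r - s)" by (simp add: lambda1_def field_simps)
  moreover have "0 \<le> (3 - \<gamma>) / 4 * (r - s)" using assms by simp
  ultimately show ?thesis by linarith
qed

lemma lambda2_ge:
  assumes "1 < \<gamma>" "s \<le> r"
  shows "s \<le> lambda2 \<gamma> s r"
proof -
  have "lambda2 \<gamma> s r - s = (\<gamma> + 1) / 4 * (r - s)" by (simp add: lambda2_def field_simps)
  moreover have "0 \<le> (\<gamma> + 1) / 4 * (r - s)" using assms by simp
  ultimately show ?thesis by linarith
qed

lemma source_nonneg:
  assumes "1 < \<gamma>" "0 \<le> \<kappa>" "0 \<le> s" "s \<le> r"
  shows "0 \<le> source \<gamma> \<kappa> s r"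
  using assms unfolding source_def by (intro mult_nonneg_nonneg) (auto intro: power_mono)

text \<open>The source contains the factor \<open>r - s\<close>, so it is small compared with \<open>\<kappa> s\<^sup>2\<close>.\<close>

lemma source_le:
  assumes "1 < \<gamma>" "\<gamma> < 3" "0 \<le> \<kappa>" "0 \<le> s" "s \<le> r" "r - s \<le> e * s" "e \<le> 1"
  shows "source \<gamma> \<kappa> s r \<le> e * \<kappa> * s\<^sup>2"
proof -
  have es: "e * s \<le> 1 * s" using assms by (intro mult_right_mono) auto
  have "(r - s) * (r + s) \<le> (e * s) * (3 * s)"
    by (rule mult_mono) (use assms es in auto)
  then have "r\<^sup>2 - s\<^sup>2 \<le> 3 * e * s\<^sup>2" by (simp add: power2_eq_square algebra_simps)
  moreover have "s\<^sup>2 \<le> r\<^sup>2" using assms by (auto intro: power_mono)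
  ultimately have "(\<gamma> - 1) / 8 * (r\<^sup>2 - s\<^sup>2) \<le> 2 / 8 * (3 * e * s\<^sup>2)"
    using assms by (intro mult_mono) auto
  also have "\<dots> \<le> e * s\<^sup>2"
    using \<open>s\<^sup>2 \<le> r\<^sup>2\<close> \<open>r\<^sup>2 - s\<^sup>2 \<le> 3 * e * s\<^sup>2\<close> by (simp add: algebra_simps)
  finally have "\<kappa> * ((\<gamma> - 1) / 8 * (r\<^sup>2 - s\<^sup>2)) \<le> \<kappa> * (e * s\<^sup>2)"
    using assms by (intro mult_left_mono)
  moreover have "source \<gamma> \<kappa> s r = \<kappa> * ((\<gamma> - 1) / 8 * (r\<^sup>2 - s\<^sup>2))" by (simp add: source_def)
  ultimately show ?thesis by (simp add: mult.assoc mult.left_commute)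
qed

lemma nonneg_derivative_imp_le:
  fixes f f' :: "real \<Rightarrow> real"
  assumes "a \<le> b" "\<And>x. a \<le> x \<Longrightarrow> x \<le> b \<Longrightarrow> (f has_real_derivative f' x) (at x within {a..b})"
    and "\<And>x. a \<le> x \<Longrightarrow> x \<le> b \<Longrightarrow> 0 \<le> f' x"
  shows "f a \<le> f b"
proof (cases "a < b")
  case True
  then obtain x where x: "x \<in> {a<..<b}" "f b - f a = f' x * (b - a)"
    using mvt_simple[of a b f "\<lambda>x. (*) (f' x)"] assms(2) by (auto simp: has_field_derivative_def)
  moreover have "0 \<le> f' x * (b - a)" using x assms by (intro mult_nonneg_nonneg) auto
  ultimately show ?thesis by linarith
qed (use assms in auto)

section \<open>The system satisfied by the time derivatives\<close>

text \<open>A classical solution together with its partial derivatives and the properties of the data that drive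
the decay; \<open>l\<close> is the left end of the duct.  The bound on \<open>k'\<close> is the limit \<open>\<delta> \<rightarrow> 0\<close> of the
hypothesis on the duct, \<open>k' \<le> k\<^sup>2 / (2 b)\<close>, since \<open>2 a = - 1 / (2 b)\<close>.  On the inflow sides the gap
\<open>R - S\<close> is bounded by \<open>(e / 2) S\<close>, half of what is claimed later inside; this strictness drives the
continuation argument.  The two upper bounds on \<open>e\<close> in terms of \<open>\<gamma>\<close> make the coupling coefficient and
the inhomogeneous term in the equation for \<open>- S\<^sub>t - a k S\<^sup>2\<close> nonnegative.\<close>

locale duct_flow =
  fixes \<gamma> a e l :: real and I :: "real set" and k k' :: "real \<Rightarrow> real"
    and S Sx St R Rx Rt :: "real \<times> real \<Rightarrow> real"
  assumes gamma: "1 < \<gamma>" "\<gamma> < 3"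
    and a: "a = (\<gamma> - 1) / (2 * (3 - \<gamma>))"
    and e: "0 < e" "e \<le> 1" "e \<le> a" "24 * (3 - \<gamma>) * e \<le> \<gamma>\<^sup>2 - 1"
    and I: "\<And>x. x \<in> I \<Longrightarrow> l \<le> x \<and> {l..x} \<subseteq> I"
    and k: "\<And>x. x \<in> I \<Longrightarrow> 0 \<le> k x" "\<And>x. x \<in> I \<Longrightarrow> (k has_real_derivative k' x) (at x within I)"
      "\<And>x. x \<in> I \<Longrightarrow> k' x \<le> - 2 * a * (k x)\<^sup>2"
    and S: "has_partials (I \<times> {0..}) S Sx St" "continuous_on (I \<times> {0..}) Sx" "continuous_on (I \<times> {0..}) St"
    and R: "has_partials (I \<times> {0..}) R Rx Rt" "continuous_on (I \<times> {0..}) Rx" "continuous_on (I \<times> {0..}) Rt"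
    and pde: "\<And>p. p \<in> I \<times> {0..} \<Longrightarrow> St p + lambda1 \<gamma> (S p) (R p) * Sx p = source \<gamma> (k (fst p)) (S p) (R p)"
      "\<And>p. p \<in> I \<times> {0..} \<Longrightarrow> Rt p + lambda2 \<gamma> (S p) (R p) * Rx p = - source \<gamma> (k (fst p)) (S p) (R p)"
    and data: "\<And>p. p \<in> I \<times> {0..} \<Longrightarrow> fst p = l \<or> snd p = 0 \<Longrightarrow>
        0 < S p \<and> S p < R p \<and> R p - S p \<le> e / 2 * S p \<and> a * k (fst p) * (S p)\<^sup>2 \<le> - St p \<and> Rt p \<le> 0"
begin

lemma a_pos: "0 < a"
  using gamma by (simp add: a)

text \<open>Here \<open>P\<close> and \<open>Q\<close> stand for \<open>- S\<^sub>t\<close> and \<open>- R\<^sub>t\<close>, and the right-hand side is the rate of change of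
\<open>P - a \<kappa> s\<^sup>2\<close> along a characteristic of speed \<open>lambda1\<close>.  Substituting \<open>sx = (g + P) / \<mu>\<close> and expanding
about \<open>P = a \<kappa> s\<^sup>2\<close> splits it into a multiple of \<open>P - a \<kappa> s\<^sup>2\<close>, a multiple of \<open>Q\<close>, and a remainder
that is at least \<open>a s\<^sup>3\<close> times \<open>- \<kappa>' - ((\<gamma> - 1) / 4 + a (\<gamma> + 1) / 4) \<kappa>\<^sup>2\<close>, up to a term
of order \<open>e \<kappa>\<^sup>2\<close>.
With the full leading-order constant \<open>2 a\<close> in place of \<open>a\<close> the coefficient of \<open>\<kappa>\<^sup>2\<close> would be exactly
\<open>2 a\<close>, matching the bound on \<open>\<kappa>'\<close> with no room to spare, and the coefficient of \<open>Q\<close> would vanish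
to leading order; taking one half leaves room in both.\<close>

lemma S_cooperative_inequality:
  fixes \<kappa> \<kappa>' s r sx P Q :: real
  defines "\<mu> \<equiv> lambda1 \<gamma> s r" and "g \<equiv> source \<gamma> \<kappa> s r"
  assumes s: "0 < s" "s \<le> r" "r - s \<le> e * s" and \<kappa>: "0 \<le> \<kappa>" "\<kappa>' \<le> - 2 * a * \<kappa>\<^sup>2"
    and P: "\<mu> * sx = g + P"
  shows "(- (\<gamma> - 1) / 4 * \<kappa> * s - (\<gamma> + 1) / 4 * (sx + a * \<kappa> * s\<^sup>2 / \<mu>) - (3 - \<gamma>) / 4 * Q / \<mu>) * (P - a * \<kappa> * s\<^sup>2)
      + ((\<gamma> - 1) / 4 * \<kappa> * r - (3 - \<gamma>) / 4 * ((g + a * \<kappa> * s\<^sup>2) / \<mu>)) * Q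
    \<le> (\<gamma> - 1) / 4 * \<kappa> * (r * Q - s * P) - ((\<gamma> + 1) / 4 * P + (3 - \<gamma>) / 4 * Q) * sx
       - a * (\<mu> * \<kappa>' * s\<^sup>2 + 2 * \<kappa> * s * g)" (is ?ineq)
    and "0 \<le> (\<gamma> - 1) / 4 * \<kappa> * r - (3 - \<gamma>) / 4 * ((g + a * \<kappa> * s\<^sup>2) / \<mu>)"
proof -
  have \<mu>: "s \<le> \<mu>" "0 < \<mu>" using lambda1_ge[of \<gamma> s r] gamma s by (auto simp: \<mu>_def)
  have g: "g \<le> e * \<kappa> * s\<^sup>2" "0 \<le> g"
    using source_le[of \<gamma> \<kappa> s r e] source_nonneg[of \<gamma> \<kappa> s r] gamma s \<kappa> e by (auto simp: g_def)
  define m where "m = (g + a * \<kappa> * s\<^sup>2) / \<mu>"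
  have m: "m \<le> (a + e) * \<kappa> * s"
  proof -
    have "g + a * \<kappa> * s\<^sup>2 \<le> (a + e) * \<kappa> * s * s" using g by (simp add: algebra_simps power2_eq_square)
    also have "\<dots> \<le> (a + e) * \<kappa> * s * \<mu>" using \<mu> \<kappa> s a_pos e by (intro mult_left_mono) auto
    finally show ?thesis using \<mu> by (simp add: m_def pos_divide_le_eq)
  qed
  have a3: "a * (3 - \<gamma>) = (\<gamma> - 1) / 2" using gamma by (simp add: a field_simps)
  show "0 \<le> (\<gamma> - 1) / 4 * \<kappa> * r - (3 - \<gamma>) / 4 * ((g + a * \<kappa> * s\<^sup>2) / \<mu>)"
  proof -
    have "(3 - \<gamma>) / 4 * m \<le> (3 - \<gamma>) / 4 * ((a + a) * \<kappa> * s)"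
    proof (rule mult_left_mono)
      have "(a + e) * (\<kappa> * s) \<le> (a + a) * (\<kappa> * s)" using e \<kappa> s by (intro mult_right_mono) auto
      then show "m \<le> (a + a) * \<kappa> * s" using m by (simp add: algebra_simps)
    qed (use gamma in auto)
    also have "\<dots> = (a * (3 - \<gamma>)) * \<kappa> * s / 2" by (simp add: field_simps)
    also have "\<dots> = (\<gamma> - 1) / 4 * \<kappa> * s" unfolding a3 by simp
    also have "\<dots> \<le> (\<gamma> - 1) / 4 * \<kappa> * r" using gamma \<kappa> s by (intro mult_left_mono) auto
    finally show ?thesis by (simp add: m_def)
  qed
  have sx: "sx = m + (P - a * \<kappa> * s\<^sup>2) / \<mu>" using P \<mu> by (simp add: m_def field_simps)
  define Y where "Y = P - a * \<kappa> * s\<^sup>2"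
  define b where "b = a * \<kappa> * s\<^sup>2"
  have PY: "P = Y + b" and sx': "sx = m + Y / \<mu>" by (simp_all add: Y_def b_def sx)
  define N where "N = - ((\<gamma> - 1) / 4 * \<kappa> * s * b) - (\<gamma> + 1) / 4 * b * m
     - a * \<mu> * \<kappa>' * s\<^sup>2 - 2 * a * \<kappa> * s * g"
  have N: "0 \<le> N"
  proof -
    have "(\<gamma> + 1) / 4 * b * m \<le> (\<gamma> + 1) / 4 * b * ((a + e) * \<kappa> * s)"
      using m gamma \<kappa> a_pos by (intro mult_left_mono) (auto simp: b_def)
    moreover have "2 * a * \<kappa> * s * g \<le> 2 * a * \<kappa> * s * (e * \<kappa> * s\<^sup>2)"
      using g \<kappa> s a_pos by (intro mult_left_mono) auto
    moreover have "s * (2 * a * \<kappa>\<^sup>2) \<le> \<mu> * (- \<kappa>')"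
      using \<mu> \<kappa> s a_pos by (intro mult_mono) auto
    then have "(a * s\<^sup>2) * (s * (2 * a * \<kappa>\<^sup>2)) \<le> (a * s\<^sup>2) * (\<mu> * (- \<kappa>'))"
      using a_pos by (intro mult_left_mono) auto
    moreover have "(a * s ^ 3 * \<kappa>\<^sup>2) * (2 * a - (\<gamma> - 1) / 4 - (\<gamma> + 1) / 4 * (a + e) - 2 * e)
        = (a * s\<^sup>2) * (s * (2 * a * \<kappa>\<^sup>2)) - (\<gamma> - 1) / 4 * \<kappa> * s * b
          - (\<gamma> + 1) / 4 * b * ((a + e) * \<kappa> * s) - 2 * a * \<kappa> * s * (e * \<kappa> * s\<^sup>2)"
      unfolding b_def by (simp add: field_simps power2_eq_square power3_eq_cube)
    moreover have "(a * s\<^sup>2) * (\<mu> * (- \<kappa>')) = - (a * \<mu> * \<kappa>' * s\<^sup>2)" by simp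
    ultimately have "(a * s ^ 3 * \<kappa>\<^sup>2) * (2 * a - (\<gamma> - 1) / 4 - (\<gamma> + 1) / 4 * (a + e) - 2 * e) \<le> N"
      unfolding N_def by linarith
    moreover have "0 \<le> 2 * a - (\<gamma> - 1) / 4 - (\<gamma> + 1) / 4 * (a + e) - 2 * e"
    proof -
      have "(\<gamma> + 1) / 4 * e \<le> 1 * e" using gamma e by (intro mult_right_mono) auto
      then have "(3 - \<gamma>) * ((\<gamma> + 1) / 4 * e + 2 * e) \<le> (3 - \<gamma>) * (3 * e)"
        using gamma by (intro mult_left_mono) auto
      also have "\<dots> \<le> (\<gamma>\<^sup>2 - 1) / 8" using e(4) by argo
      also have "\<dots> = 2 * (a * (3 - \<gamma>)) - (3 - \<gamma>) * (\<gamma> - 1) / 4 - (\<gamma> + 1) / 4 * (a * (3 - \<gamma>))"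
        unfolding a3 by (simp add: field_simps power2_eq_square)
      also have "\<dots> = (3 - \<gamma>) * (2 * a - (\<gamma> - 1) / 4 - (\<gamma> + 1) / 4 * (a + e) - 2 * e)
          + (3 - \<gamma>) * ((\<gamma> + 1) / 4 * e + 2 * e)"
        by (simp add: field_simps)
      finally have "0 \<le> (3 - \<gamma>) * (2 * a - (\<gamma> - 1) / 4 - (\<gamma> + 1) / 4 * (a + e) - 2 * e)"
        by simp
      then show ?thesis using gamma by (simp add: zero_le_mult_iff)
    qed
    ultimately show ?thesis
      using mult_nonneg_nonneg[of "a * s ^ 3 * \<kappa>\<^sup>2"] a_pos s by (smt (verit) mult_nonneg_nonneg zero_le_power2 zero_less_power)
  qed
  have "(\<gamma> - 1) / 4 * \<kappa> * (r * Q - s * P) - ((\<gamma> + 1) / 4 * P + (3 - \<gamma>) / 4 * Q) * sx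
       - a * (\<mu> * \<kappa>' * s\<^sup>2 + 2 * \<kappa> * s * g)
    = (- (\<gamma> - 1) / 4 * \<kappa> * s - (\<gamma> + 1) / 4 * (sx + b / \<mu>) - (3 - \<gamma>) / 4 * Q / \<mu>) * Y
      + ((\<gamma> - 1) / 4 * \<kappa> * r - (3 - \<gamma>) / 4 * m) * Q + N"
    unfolding N_def PY sx' by (simp add: algebra_simps add_divide_distrib diff_divide_distrib)
  then show ?ineq using N by (simp add: Y_def b_def m_def)
qed

text \<open>The analogous expansion for \<open>Q = - R\<^sub>t\<close> along a characteristic of speed \<open>lambda2\<close>.  It starts from
\<open>rx = (Q - g) / \<mu>\<close>; the coefficient of \<open>P\<close> is nonnegative because \<open>g \<ge> 0\<close>, so \<open>P\<close> may be replaced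
by the smaller \<open>P - a \<kappa> s\<^sup>2\<close>.\<close>

lemma R_cooperative_inequality:
  fixes \<kappa> s r rx P Q :: real
  defines "\<mu> \<equiv> lambda2 \<gamma> s r" and "g \<equiv> source \<gamma> \<kappa> s r"
  assumes s: "0 < s" "s \<le> r" and \<kappa>: "0 \<le> \<kappa>" and Q: "\<mu> * rx = Q - g"
  shows "(- (\<gamma> - 1) / 4 * \<kappa> * r - (\<gamma> + 1) / 4 * rx - (3 - \<gamma>) / 4 * P / \<mu>) * Q
      + ((\<gamma> - 1) / 4 * \<kappa> * s + (3 - \<gamma>) / 4 * g / \<mu>) * (P - a * \<kappa> * s\<^sup>2)
    \<le> (\<gamma> - 1) / 4 * \<kappa> * (s * P - r * Q) - ((3 - \<gamma>) / 4 * P + (\<gamma> + 1) / 4 * Q) * rx" (is ?ineq)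
    and "0 \<le> (\<gamma> - 1) / 4 * \<kappa> * s + (3 - \<gamma>) / 4 * g / \<mu>"
proof -
  have \<mu>: "0 < \<mu>" using lambda2_ge[of \<gamma> s r] gamma s by (auto simp: \<mu>_def)
  have g: "0 \<le> g" using source_nonneg[of \<gamma> \<kappa> s r] gamma s \<kappa> by (auto simp: g_def)
  show *: "0 \<le> (\<gamma> - 1) / 4 * \<kappa> * s + (3 - \<gamma>) / 4 * g / \<mu>"
    using \<mu> g gamma \<kappa> s by (intro add_nonneg_nonneg) auto
  have rx: "rx = Q / \<mu> - g / \<mu>" using Q \<mu> by (simp add: field_simps)
  have "(\<gamma> - 1) / 4 * \<kappa> * (s * P - r * Q) - ((3 - \<gamma>) / 4 * P + (\<gamma> + 1) / 4 * Q) * rx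
    = (- (\<gamma> - 1) / 4 * \<kappa> * r - (\<gamma> + 1) / 4 * rx - (3 - \<gamma>) / 4 * P / \<mu>) * Q
      + ((\<gamma> - 1) / 4 * \<kappa> * s + (3 - \<gamma>) / 4 * g / \<mu>) * P"
    unfolding rx by (simp add: algebra_simps add_divide_distrib diff_divide_distrib)
  moreover have "((\<gamma> - 1) / 4 * \<kappa> * s + (3 - \<gamma>) / 4 * g / \<mu>) * (P - a * \<kappa> * s\<^sup>2)
      \<le> ((\<gamma> - 1) / 4 * \<kappa> * s + (3 - \<gamma>) / 4 * g / \<mu>) * P"
    using * \<kappa> a_pos by (intro mult_left_mono) auto
  ultimately show ?ineq by linarith
qed

text \<open>The excess of \<open>- S\<^sub>t\<close> over the rate of decrease that makes \<open>1 / S\<close> grow linearly in time.\<close>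

definition decay_margin :: "real \<times> real \<Rightarrow> real" where "decay_margin p = - St p - a * k (fst p) * (S p)\<^sup>2"

lemma rectangle_subset: "X \<in> I \<Longrightarrow> {l..X} \<times> {0..T} \<subseteq> I \<times> {0..}"
  using I by force

lemma continuous_on_k: "continuous_on I k"
  using k(2) by (meson DERIV_continuous_on)

lemma continuous_on_k_fst:
  assumes "X \<in> I"
  shows "continuous_on ({l..X} \<times> {0..T}) (\<lambda>p. k (fst p))"
  by (rule continuous_on_compose2[OF continuous_on_k])
    (use rectangle_subset[OF assms, of T] in \<open>auto intro!: continuous_intros\<close>)

lemma continuous_on_rectangle:
  assumes "X \<in> I"
  shows "continuous_on ({l..X} \<times> {0..T}) S" "continuous_on ({l..X} \<times> {0..T}) Sx"
    "continuous_on ({l..X} \<times> {0..T}) St" "continuous_on ({l..X} \<times> {0..T}) R"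
    "continuous_on ({l..X} \<times> {0..T}) Rx" "continuous_on ({l..X} \<times> {0..T}) Rt"
  using S(2,3) R(2,3) has_partials_continuous_on[OF S(1)] has_partials_continuous_on[OF R(1)]
  by (auto intro: continuous_on_subset[OF _ rectangle_subset[OF assms]])

lemma has_partials_time_shift:
  assumes f: "has_partials (I \<times> {0..}) f fx ft" and X: "X \<in> I" and h: "0 \<le> h"
  shows "has_partials ({l..X} \<times> {0..T}) (\<lambda>p. f (fst p, snd p + h))
    (\<lambda>p. fx (fst p, snd p + h)) (\<lambda>p. ft (fst p, snd p + h))"
  unfolding has_partials_def
proof
  fix p assume p: "p \<in> {l..X} \<times> {0..T}"
  let ?s = "\<lambda>p::real \<times> real. (fst p, snd p + h)"
  have sub: "?s ` ({l..X} \<times> {0..T}) \<subseteq> I \<times> {0..}"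
    using rectangle_subset[OF X, of "T"] h by force
  have "(?s has_derivative (\<lambda>v. v)) (at p within {l..X} \<times> {0..T})"
    by (auto intro!: derivative_eq_intros)
  moreover have "(f has_derivative (\<lambda>v. fx (?s p) * fst v + ft (?s p) * snd v))
      (at (?s p) within ?s ` ({l..X} \<times> {0..T}))"
    using has_partials_subset[OF f sub] p unfolding has_partials_def by blast
  ultimately show "((\<lambda>p. f (?s p)) has_derivative (\<lambda>v. fx (?s p) * fst v + ft (?s p) * snd v))
      (at p within {l..X} \<times> {0..T})"
    using has_derivative_in_compose[of ?s "\<lambda>v. v"] by fastforce
qed

lemma has_partials_k:
  assumes "X \<in> I"
  shows "has_partials ({l..X} \<times> {0..T}) (\<lambda>p. k (fst p)) (\<lambda>p. k' (fst p)) (\<lambda>_. 0)"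
  unfolding has_partials_def
proof
  fix p :: "real \<times> real" assume p: "p \<in> {l..X} \<times> {0..T}"
  have "(k has_derivative (*) (k' (fst p))) (at (fst p) within fst ` ({l..X} \<times> {0..T}))"
    unfolding has_field_derivative_def[symmetric]
    by (rule DERIV_subset[OF k(2)]) (use p rectangle_subset[OF assms, of T] in auto)
  then show "((\<lambda>p. k (fst p)) has_derivative (\<lambda>v. k' (fst p) * fst v + 0 * snd v))
      (at p within {l..X} \<times> {0..T})"
    using has_derivative_in_compose[OF has_derivative_fst[OF has_derivative_ident]] by fastforce
qed

definition "time_quotient h f p = (f (fst p, snd p + h) - f p) / h" for h :: real and f :: "real \<times> real \<Rightarrow> real"

text \<open>An exact identity: \<open>lambda1\<close> is linear and the source is quadratic, so subtracting the equation at
time \<open>t\<close> from the one at time \<open>t + h\<close> reproduces the differentiated equation, with some factors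
averaged over, or evaluated at, the later time.\<close>

lemma S_difference_quotient_transport:
  assumes "p \<in> I \<times> {0..}" "0 < h"
  shows "- time_quotient h St p + lambda1 \<gamma> (S p) (R p) * (- time_quotient h Sx p)
    = - ((\<gamma> - 1) / 8 * k (fst p) * ((R (fst p, snd p + h) + R p) * time_quotient h R p - (S (fst p, snd p + h) + S p) * time_quotient h S p))
      + ((\<gamma> + 1) / 4 * time_quotient h S p + (3 - \<gamma>) / 4 * time_quotient h R p) * Sx (fst p, snd p + h)"
proof -
  have q: "(fst p, snd p + h) \<in> I \<times> {0..}" using assms by auto
  define q where "q = (fst p, snd p + h)"
  have St: "St p = source \<gamma> (k (fst p)) (S p) (R p) - lambda1 \<gamma> (S p) (R p) * Sx p"
    "St q = source \<gamma> (k (fst p)) (S q) (R q) - lambda1 \<gamma> (S q) (R q) * Sx q"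
    using pde(1)[OF assms(1)] pde(1)[OF q] by (auto simp: q_def)
  show ?thesis
    unfolding time_quotient_def q_def[symmetric] St source_def lambda1_def using assms(2)
    by (simp add: field_simps power2_eq_square)
qed

lemma R_difference_quotient_transport:
  assumes "p \<in> I \<times> {0..}" "0 < h"
  shows "- time_quotient h Rt p + lambda2 \<gamma> (S p) (R p) * (- time_quotient h Rx p)
    = (\<gamma> - 1) / 8 * k (fst p) * ((R (fst p, snd p + h) + R p) * time_quotient h R p - (S (fst p, snd p + h) + S p) * time_quotient h S p)
      + ((3 - \<gamma>) / 4 * time_quotient h S p + (\<gamma> + 1) / 4 * time_quotient h R p) * Rx (fst p, snd p + h)"
proof -
  have q: "(fst p, snd p + h) \<in> I \<times> {0..}" using assms by auto
  define q where "q = (fst p, snd p + h)"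
  have Rt: "Rt p = - source \<gamma> (k (fst p)) (S p) (R p) - lambda2 \<gamma> (S p) (R p) * Rx p"
    "Rt q = - source \<gamma> (k (fst p)) (S q) (R q) - lambda2 \<gamma> (S q) (R q) * Rx q"
    using pde(2)[OF assms(1)] pde(2)[OF q] by (auto simp: q_def)
  show ?thesis
    unfolding time_quotient_def q_def[symmetric] Rt source_def lambda2_def using assms(2)
    by (simp add: field_simps power2_eq_square)
qed

text \<open>The value that the derivative of \<open>- S\<^sub>t\<close> along a characteristic of speed \<open>lambda1\<close> has
when \<open>S\<close> is twice differentiable; for a \<open>C\<^sup>1\<close> solution it is the uniform limit of the derivatives of
the difference quotients. The same is true of \<open>R_rate\<close>, for \<open>- R\<^sub>t\<close> and \<open>lambda2\<close>.\<close>

definition S_rate :: "real \<times> real \<Rightarrow> real" where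
  "S_rate p = (\<gamma> - 1) / 4 * k (fst p) * (R p * - Rt p - S p * - St p)
     - ((\<gamma> + 1) / 4 * - St p + (3 - \<gamma>) / 4 * - Rt p) * Sx p"

definition R_rate :: "real \<times> real \<Rightarrow> real" where
  "R_rate p = (\<gamma> - 1) / 4 * k (fst p) * (S p * - St p - R p * - Rt p)
     - ((3 - \<gamma>) / 4 * - St p + (\<gamma> + 1) / 4 * - Rt p) * Rx p"

lemma approximation:
  assumes X: "X \<in> I" and \<epsilon>: "0 < \<epsilon>"
  obtains h where "0 < h" "\<And>p. p \<in> {l..X} \<times> {0..T} \<Longrightarrow>
      \<bar>- time_quotient h S p + St p\<bar> \<le> \<epsilon> \<and> \<bar>- time_quotient h R p + Rt p\<bar> \<le> \<epsilon> \<and>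
      S_rate p - \<epsilon> \<le> - time_quotient h St p + lambda1 \<gamma> (S p) (R p) * (- time_quotient h Sx p) \<and>
      R_rate p - \<epsilon> \<le> - time_quotient h Rt p + lambda2 \<gamma> (S p) (R p) * (- time_quotient h Rx p)"
proof -
  let ?K = "{l..X} \<times> {0..T}"
  let ?s = "\<lambda>h p::real \<times> real. (fst p, snd p + h)"
  have K: "compact ?K" by (intro compact_Times compact_Icc)
  note cont = continuous_on_rectangle[OF X, of "T + 1"] and cont' = continuous_on_rectangle[OF X, of T]
  note sub = has_partials_subset[OF _ rectangle_subset[OF X, of "T + 1"]]
  have dS: "uniform_limit ?K (\<lambda>h. time_quotient h S) St (at_right 0)"
    unfolding time_quotient_def by (rule uniform_limit_time_difference_quotient[OF sub[OF S(1)] cont(3)])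
  have dR: "uniform_limit ?K (\<lambda>h. time_quotient h R) Rt (at_right 0)"
    unfolding time_quotient_def by (rule uniform_limit_time_difference_quotient[OF sub[OF R(1)] cont(6)])
  note sh = cont(1,2,4,5)[THEN uniform_limit_time_shift]
  note uni = uniform_limit_mult_continuous[OF _ _ K] uniform_limit_const uniform_limit_add
    uniform_limit_minus uniform_limit_uminus sh dS dR
  have kc: "continuous_on ?K (\<lambda>p. c * k (fst p))" for c
    by (intro continuous_intros continuous_on_k_fst X)
  have 1: "uniform_limit ?K
    (\<lambda>h p. - ((\<gamma> - 1) / 8 * k (fst p) * ((R (?s h p) + R p) * time_quotient h R p - (S (?s h p) + S p) * time_quotient h S p))
      + ((\<gamma> + 1) / 4 * time_quotient h S p + (3 - \<gamma>) / 4 * time_quotient h R p) * Sx (?s h p))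
    (\<lambda>p. - ((\<gamma> - 1) / 8 * k (fst p) * ((R p + R p) * Rt p - (S p + S p) * St p))
      + ((\<gamma> + 1) / 4 * St p + (3 - \<gamma>) / 4 * Rt p) * Sx p) (at_right 0)"
    by (intro uni continuous_intros cont' kc)
  have 2: "uniform_limit ?K
    (\<lambda>h p. (\<gamma> - 1) / 8 * k (fst p) * ((R (?s h p) + R p) * time_quotient h R p - (S (?s h p) + S p) * time_quotient h S p)
      + ((3 - \<gamma>) / 4 * time_quotient h S p + (\<gamma> + 1) / 4 * time_quotient h R p) * Rx (?s h p))
    (\<lambda>p. (\<gamma> - 1) / 8 * k (fst p) * ((R p + R p) * Rt p - (S p + S p) * St p)
      + ((3 - \<gamma>) / 4 * St p + (\<gamma> + 1) / 4 * Rt p) * Rx p) (at_right 0)"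
    by (intro uni continuous_intros cont' kc)
  have "\<forall>\<^sub>F h in at_right 0. 0 < h \<and> (\<forall>p\<in>?K.
      \<bar>- time_quotient h S p + St p\<bar> \<le> \<epsilon> \<and> \<bar>- time_quotient h R p + Rt p\<bar> \<le> \<epsilon> \<and>
      S_rate p - \<epsilon> \<le> - time_quotient h St p + lambda1 \<gamma> (S p) (R p) * (- time_quotient h Sx p) \<and>
      R_rate p - \<epsilon> \<le> - time_quotient h Rt p + lambda2 \<gamma> (S p) (R p) * (- time_quotient h Rx p))"
    using uniform_limitD[OF dS \<epsilon>] uniform_limitD[OF dR \<epsilon>] uniform_limitD[OF 1 \<epsilon>]
      uniform_limitD[OF 2 \<epsilon>] eventually_at_right_less[of 0]
  proof eventually_elim
    case (elim h)
    show ?case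
    proof (intro conjI ballI)
      fix p assume p: "p \<in> ?K"
      then have p': "p \<in> I \<times> {0..}" using rectangle_subset[OF X] by blast
      note e = elim(1-4)[rule_format, OF p]
      show "\<bar>- time_quotient h S p + St p\<bar> \<le> \<epsilon>" "\<bar>- time_quotient h R p + Rt p\<bar> \<le> \<epsilon>"
        using e(1,2) by (auto simp: dist_real_def)
      have "S_rate p = - ((\<gamma> - 1) / 8 * k (fst p) * ((R p + R p) * Rt p - (S p + S p) * St p))
          + ((\<gamma> + 1) / 4 * St p + (3 - \<gamma>) / 4 * Rt p) * Sx p"
        by (simp add: S_rate_def field_simps)
      then show "S_rate p - \<epsilon> \<le> - time_quotient h St p + lambda1 \<gamma> (S p) (R p) * (- time_quotient h Sx p)"
        using e(3) unfolding S_difference_quotient_transport[OF p' elim(5)] dist_real_def by linarith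
      have "R_rate p = (\<gamma> - 1) / 8 * k (fst p) * ((R p + R p) * Rt p - (S p + S p) * St p)
          + ((3 - \<gamma>) / 4 * St p + (\<gamma> + 1) / 4 * Rt p) * Rx p"
        by (simp add: R_rate_def field_simps)
      then show "R_rate p - \<epsilon> \<le> - time_quotient h Rt p + lambda2 \<gamma> (S p) (R p) * (- time_quotient h Rx p)"
        using e(4) unfolding R_difference_quotient_transport[OF p' elim(5)] dist_real_def by linarith
    qed (rule elim(5))
  qed
  from eventually_happens'[OF trivial_limit_at_right_real this] show ?thesis using that by blast
qed

text \<open>The conditional form of the main estimate: on a rectangle where \<open>S\<close> is positive and the gap is small,
the minimum principle applies to the decay margin and \<open>- R\<^sub>t\<close>, approximated through time difference
quotients of \<open>S\<close> and \<open>R\<close>.  The term \<open>a k S\<^sup>2\<close> is \<open>C\<^sup>1\<close> and is not approximated.\<close>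

lemma time_derivatives_signed:
  assumes X: "X \<in> I"
    and good: "\<And>p. p \<in> {l..X} \<times> {0..T} \<Longrightarrow> 0 < S p \<and> S p \<le> R p \<and> R p - S p \<le> e * S p"
    and p: "p \<in> {l..X} \<times> {0..T}"
  shows "0 \<le> decay_margin p \<and> 0 \<le> - Rt p"
proof -
  let ?K = "{l..X} \<times> {0..T}"
  define m1 where "m1 p = lambda1 \<gamma> (S p) (R p)" for p
  define m2 where "m2 p = lambda2 \<gamma> (S p) (R p)" for p
  define g where "g p = source \<gamma> (k (fst p)) (S p) (R p)" for p
  define c1 where "c1 p = - (\<gamma> - 1) / 4 * k (fst p) * S p
      - (\<gamma> + 1) / 4 * (Sx p + a * k (fst p) * (S p)\<^sup>2 / m1 p) - (3 - \<gamma>) / 4 * - Rt p / m1 p" for p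
  define d1 where "d1 p = (\<gamma> - 1) / 4 * k (fst p) * R p
      - (3 - \<gamma>) / 4 * ((g p + a * k (fst p) * (S p)\<^sup>2) / m1 p)" for p
  define c2 where "c2 p = - (\<gamma> - 1) / 4 * k (fst p) * R p - (\<gamma> + 1) / 4 * Rx p
      - (3 - \<gamma>) / 4 * - St p / m2 p" for p
  define d2 where "d2 p = (\<gamma> - 1) / 4 * k (fst p) * S p + (3 - \<gamma>) / 4 * g p / m2 p" for p
  have I': "q \<in> I \<times> {0..}" if "q \<in> ?K" for q using that rectangle_subset[OF X] by blast
  have m: "S q \<le> m1 q" "S q \<le> m2 q" "0 < m1 q" "0 < m2 q" if "q \<in> ?K" for q
    using good[OF that] gamma lambda1_ge[of \<gamma> "S q" "R q"] lambda2_ge[of \<gamma> "S q" "R q"]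
    by (auto simp: m1_def m2_def)
  have kq: "0 \<le> k (fst q)" "k' (fst q) \<le> - 2 * a * (k (fst q))\<^sup>2" if "q \<in> ?K" for q
    using I'[OF that] k(1,3) by auto
  have ineq1: "c1 q * decay_margin q + d1 q * - Rt q
      \<le> S_rate q - a * (m1 q * k' (fst q) * (S q)\<^sup>2 + 2 * k (fst q) * S q * g q)"
    and d1: "0 \<le> d1 q" if "q \<in> ?K" for q
    using S_cooperative_inequality(1)[of "S q" "R q" "k (fst q)" "k' (fst q)" "Sx q" "- St q" "- Rt q"]
      S_cooperative_inequality(2)[of "S q" "R q" "k (fst q)" "k' (fst q)" "Sx q" "- St q"]
      good[OF that] kq[OF that] pde(1)[OF I'[OF that]]
    by (auto simp: c1_def d1_def S_rate_def m1_def g_def decay_margin_def)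
  have ineq2: "c2 q * - Rt q + d2 q * decay_margin q \<le> R_rate q" and d2: "0 \<le> d2 q" if "q \<in> ?K" for q
    using R_cooperative_inequality(1)[of "S q" "R q" "k (fst q)" "Rx q" "- Rt q" "- St q"]
      R_cooperative_inequality(2)[of "S q" "R q" "k (fst q)" "Rx q" "- Rt q"]
      good[OF that] kq[OF that] pde(2)[OF I'[OF that]]
    by (auto simp: c2_def d2_def R_rate_def m2_def g_def decay_margin_def)
  have K: "compact ?K" by (intro compact_Times compact_Icc)
  note cont = continuous_on_rectangle[OF X, of T] continuous_on_k_fst[OF X, of T]
  have cg: "continuous_on ?K g" unfolding g_def source_def by (intro continuous_intros cont)
  have cm: "continuous_on ?K m1" "continuous_on ?K m2"
    unfolding m1_def m2_def lambda1_def lambda2_def by (intro continuous_intros cont)+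
  have m0: "\<forall>q\<in>?K. m1 q \<noteq> 0" "\<forall>q\<in>?K. m2 q \<noteq> 0" using m by (metis less_irrefl)+
  have "continuous_on ?K c1" "continuous_on ?K d1" "continuous_on ?K c2" "continuous_on ?K d2"
    unfolding c1_def d1_def c2_def d2_def by (intro continuous_intros cont cm cg m0; simp)+
  then obtain L1 L2 L3 L4 where L: "\<And>q. q \<in> ?K \<Longrightarrow>
      \<bar>c1 q\<bar> \<le> L1 \<and> \<bar>d1 q\<bar> \<le> L2 \<and> \<bar>c2 q\<bar> \<le> L3 \<and> \<bar>d2 q\<bar> \<le> L4"
    using continuous_on_compact_bounded_abs[OF K] by metis
  define L where "L = max (max L1 L2) (max L3 L4)"
  show ?thesis
  proof (rule cooperative_min_principle[of l X T decay_margin "\<lambda>p. - Rt p" c1 d1 m1 c2 d2 m2 L p])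
    fix \<epsilon> :: real assume "\<epsilon> > 0"
    then obtain h where h: "0 < h" "\<And>q. q \<in> ?K \<Longrightarrow>
      \<bar>- time_quotient h S q + St q\<bar> \<le> \<epsilon> \<and> \<bar>- time_quotient h R q + Rt q\<bar> \<le> \<epsilon> \<and>
      S_rate q - \<epsilon> \<le> - time_quotient h St q + m1 q * (- time_quotient h Sx q) \<and>
      R_rate q - \<epsilon> \<le> - time_quotient h Rt q + m2 q * (- time_quotient h Rx q)"
      unfolding m1_def m2_def using approximation[OF X, of \<epsilon> T] by blast
    let ?U = "\<lambda>q. - time_quotient h S q - a * k (fst q) * (S q)\<^sup>2"
    let ?Ux = "\<lambda>q. - time_quotient h Sx q - a * (k' (fst q) * (S q)\<^sup>2 + 2 * k (fst q) * S q * Sx q)"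
    let ?Ut = "\<lambda>q. - time_quotient h St q - a * (2 * k (fst q) * S q * St q)"
    note parts = has_partials_time_shift[OF S(1) X, of h T] has_partials_time_shift[OF R(1) X, of h T]
      has_partials_subset[OF S(1) rectangle_subset[OF X, of T]]
      has_partials_subset[OF R(1) rectangle_subset[OF X, of T]] has_partials_k[OF X, of T]
    have "has_partials ?K ?U ?Ux ?Ut"
      using parts h(1) unfolding has_partials_def time_quotient_def
      by (auto intro!: derivative_eq_intros simp: fun_eq_iff field_simps power2_eq_square)
    moreover have "has_partials ?K (\<lambda>q. - time_quotient h R q) (\<lambda>q. - time_quotient h Rx q) (\<lambda>q. - time_quotient h Rt q)"
      using parts h(1) unfolding has_partials_def time_quotient_def
      by (auto intro!: derivative_eq_intros simp: fun_eq_iff field_simps)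
    moreover have "\<bar>?U q - decay_margin q\<bar> \<le> \<epsilon> \<and> \<bar>- time_quotient h R q - - Rt q\<bar> \<le> \<epsilon> \<and>
         c1 q * decay_margin q + d1 q * - Rt q - \<epsilon> \<le> ?Ut q + m1 q * ?Ux q \<and>
         c2 q * - Rt q + d2 q * decay_margin q - \<epsilon> \<le> - time_quotient h Rt q + m2 q * - time_quotient h Rx q" if q: "q \<in> ?K" for q
    proof -
      have "St q + m1 q * Sx q = g q" using pde(1)[OF I'[OF q]] by (simp add: m1_def g_def)
      then have "?Ut q + m1 q * ?Ux q = - time_quotient h St q + m1 q * (- time_quotient h Sx q)
          - a * (m1 q * k' (fst q) * (S q)\<^sup>2 + 2 * k (fst q) * S q * g q)"
        by (simp only: \<open>St q + m1 q * Sx q = g q\<close>[symmetric]) (simp add: algebra_simps)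
      then show ?thesis using h(2)[OF q] ineq1[OF q] ineq2[OF q] by (simp add: decay_margin_def)
    qed
    ultimately show "\<exists>U Ux Ut V Vx Vt. has_partials ?K U Ux Ut \<and> has_partials ?K V Vx Vt \<and>
      (\<forall>p\<in>?K. \<bar>U p - decay_margin p\<bar> \<le> \<epsilon> \<and> \<bar>V p - - Rt p\<bar> \<le> \<epsilon> \<and>
         c1 p * decay_margin p + d1 p * - Rt p - \<epsilon> \<le> Ut p + m1 p * Ux p \<and>
         c2 p * - Rt p + d2 p * decay_margin p - \<epsilon> \<le> Vt p + m2 p * Vx p)"
      by blast
  next
    fix q assume q: "q \<in> ?K"
    then show "0 \<le> m1 q \<and> 0 \<le> m2 q \<and> \<bar>c1 q\<bar> \<le> L \<and> \<bar>c2 q\<bar> \<le> L \<and>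
        0 \<le> d1 q \<and> d1 q \<le> L \<and> 0 \<le> d2 q \<and> d2 q \<le> L"
      using m[OF q] d1[OF q] d2[OF q] L[OF q] by (auto simp: L_def)
  next
    fix q assume "q \<in> ?K" "fst q = l \<or> snd q = 0"
    then show "0 \<le> decay_margin q \<and> 0 \<le> - Rt q" using data[OF I'] by (auto simp: decay_margin_def)
  qed (rule p)
qed

section \<open>Invariance of the region where the gap is small and positive\<close>

lemma boundary_positive_bound:
  fixes f :: "real \<times> real \<Rightarrow> real"
  assumes X: "X \<in> I" and f: "continuous_on ({l..X} \<times> {0..T}) f"
    and pos: "\<And>p. p \<in> {l..X} \<times> {0..T} \<Longrightarrow> fst p = l \<or> snd p = 0 \<Longrightarrow> 0 < f p"
  obtains m where "0 < m" "\<And>p. p \<in> {l..X} \<times> {0..T} \<Longrightarrow> fst p = l \<or> snd p = 0 \<Longrightarrow> m \<le> f p"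
proof -
  define B where "B = {p \<in> {l..X} \<times> {0..T}. fst p = l \<or> snd p = 0}"
  have "B = ({l..X} \<times> {0..T}) \<inter> ({l} \<times> UNIV \<union> UNIV \<times> {0})" by (auto simp: B_def)
  then have "compact B"
    by (auto intro!: compact_Int_closed compact_Times closed_Un closed_Times compact_Icc closed_singleton)
  show thesis
  proof (cases "B = {}")
    case True
    then have "1 \<le> f p" if "p \<in> {l..X} \<times> {0..T}" "fst p = l \<or> snd p = 0" for p
      using that unfolding B_def by blast
    then show ?thesis using that[of 1] by simp
  next
    case False
    moreover have "continuous_on B f" by (rule continuous_on_subset[OF f]) (auto simp: B_def)
    ultimately obtain q where q: "q \<in> B" "\<And>p. p \<in> B \<Longrightarrow> f q \<le> f p"
      using continuous_attains_inf[OF \<open>compact B\<close>, of f] by blast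
    then show ?thesis using that[of "f q"] pos[of q] by (auto simp: B_def)
  qed
qed

text \<open>The source is nonnegative, so \<open>S\<close> increases along the characteristics of its own speed.\<close>

lemma S_ge_of_boundary:
  assumes X: "X \<in> I" and p: "p \<in> {l..X} \<times> {0..T}"
    and good: "\<And>p. p \<in> {l..X} \<times> {0..T} \<Longrightarrow> 0 \<le> S p \<and> S p \<le> R p"
    and m: "\<And>p. p \<in> {l..X} \<times> {0..T} \<Longrightarrow> fst p = l \<or> snd p = 0 \<Longrightarrow> m \<le> S p"
  shows "m \<le> S p"
proof -
  have "0 \<le> S p - m"
  proof (rule transport_min_principle[of l X T "\<lambda>p. S p - m" Sx St "\<lambda>p. lambda1 \<gamma> (S p) (R p)" "\<lambda>_. 0" 0])
    show "has_partials ({l..X} \<times> {0..T}) (\<lambda>p. S p - m) Sx St"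
      using has_partials_subset[OF S(1) rectangle_subset[OF X, of T]]
      unfolding has_partials_def by (auto intro!: derivative_eq_intros)
    fix q assume q: "q \<in> {l..X} \<times> {0..T}"
    then have "q \<in> I \<times> {0..}" using rectangle_subset[OF X] by blast
    then show "0 \<le> lambda1 \<gamma> (S q) (R q) \<and> \<bar>0\<bar> \<le> (0::real) \<and>
        0 * (S q - m) \<le> St q + lambda1 \<gamma> (S q) (R q) * Sx q"
      using pde(1) good[OF q] gamma k(1) lambda1_ge[of \<gamma> "S q" "R q"]
      by (auto intro!: source_nonneg)
  qed (use p m in auto)
  then show ?thesis by simp
qed

text \<open>Along a characteristic of speed \<open>lambda1\<close>, \<open>S\<close> increases and the gap \<open>w = R - S\<close> decreases.  The latter
needs a lower bound for \<open>w R\<^sub>x\<close>: from \<open>R\<^sub>t \<le> 0\<close> one gets \<open>lambda2 R\<^sub>x \<ge> - g\<close>, and \<open>w \<le> lambda2\<close>.\<close>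

lemma gap_le_of_boundary:
  assumes X: "X \<in> I" and p: "p \<in> {l..X} \<times> {0..T}"
    and good: "\<And>p. p \<in> {l..X} \<times> {0..T} \<Longrightarrow> 0 < S p \<and> S p \<le> R p \<and> R p - S p \<le> e * S p"
  shows "R p - S p \<le> e / 2 * S p"
proof -
  have "0 \<le> (1 + e / 2) * S p - R p"
  proof (rule transport_min_principle[of l X T "\<lambda>p. (1 + e / 2) * S p - R p"
        "\<lambda>p. (1 + e / 2) * Sx p - Rx p" "\<lambda>p. (1 + e / 2) * St p - Rt p"
        "\<lambda>p. lambda1 \<gamma> (S p) (R p)" "\<lambda>_. 0" 0])
    show "has_partials ({l..X} \<times> {0..T}) (\<lambda>p. (1 + e / 2) * S p - R p)
        (\<lambda>p. (1 + e / 2) * Sx p - Rx p) (\<lambda>p. (1 + e / 2) * St p - Rt p)"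
      using has_partials_subset[OF S(1) rectangle_subset[OF X, of T]]
        has_partials_subset[OF R(1) rectangle_subset[OF X, of T]]
      unfolding has_partials_def
      by (auto intro!: derivative_eq_intros simp: fun_eq_iff algebra_simps)
    fix q assume q: "q \<in> {l..X} \<times> {0..T}"
    then have q': "q \<in> I \<times> {0..}" using rectangle_subset[OF X] by blast
    define g where "g = source \<gamma> (k (fst q)) (S q) (R q)"
    define m1 where "m1 = lambda1 \<gamma> (S q) (R q)"
    define m2 where "m2 = lambda2 \<gamma> (S q) (R q)"
    define w where "w = R q - S q"
    have g: "0 \<le> g" using good[OF q] gamma k(1) q' by (auto simp: g_def intro!: source_nonneg)
    have m: "S q \<le> m1" "S q \<le> m2" "0 < m2"
      using lambda1_ge[of \<gamma> "S q" "R q"] lambda2_ge[of \<gamma> "S q" "R q"] gamma good[OF q]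
      by (auto simp: m1_def m2_def)
    have mm: "m2 = m1 + (\<gamma> - 1) / 2 * w"
      by (simp add: m1_def m2_def w_def lambda1_def lambda2_def field_simps)
    have w: "0 \<le> w" "w \<le> m2"
    proof -
      show "0 \<le> w" using good[OF q] by (simp add: w_def)
      have "e * S q \<le> 1 * S q" using e good[OF q] by (intro mult_right_mono) auto
      then show "w \<le> m2" using good[OF q] m unfolding w_def by linarith
    qed
    have pde': "St q + m1 * Sx q = g" "Rt q + m2 * Rx q = - g"
      using pde q' by (auto simp: m1_def m2_def g_def)
    have "w * Rx q \<ge> - g"
    proof -
      have "m2 * Rx q \<ge> - g"
        using pde'(2) time_derivatives_signed[OF X good q] by simp
      then have "w * (m2 * Rx q) \<ge> w * (- g)" using w by (intro mult_left_mono)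
      moreover have "m2 * g \<ge> w * g" using w g by (intro mult_right_mono)
      ultimately have "m2 * (w * Rx q) \<ge> m2 * (- g)" by (simp add: algebra_simps)
      then show ?thesis using m(3) by (rule mult_left_le_imp_le)
    qed
    then have "(\<gamma> - 1) / 2 * (w * Rx q) \<ge> (\<gamma> - 1) / 2 * (- g)"
      using gamma by (intro mult_left_mono) auto
    moreover have "(\<gamma> - 1) / 2 * g \<le> 1 * g" using gamma g by (intro mult_right_mono) auto
    moreover have "0 \<le> e / 2 * g" "(1 + e / 2) * g = g + e / 2 * g" using e g by (simp_all add: algebra_simps)
    ultimately have "0 \<le> (1 + e / 2) * g - - g + (\<gamma> - 1) / 2 * (w * Rx q)"
      using g by linarith
    also have "\<dots> = (1 + e / 2) * (St q + m1 * Sx q) - (Rt q + m2 * Rx q) + (\<gamma> - 1) / 2 * (w * Rx q)"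
      unfolding pde' ..
    also have "\<dots> = (1 + e / 2) * St q - Rt q + m1 * ((1 + e / 2) * Sx q - Rx q)"
      unfolding mm by (simp add: algebra_simps)
    finally show "0 \<le> lambda1 \<gamma> (S q) (R q) \<and> \<bar>0\<bar> \<le> (0::real) \<and> 0 * ((1 + e / 2) * S q - R q)
        \<le> (1 + e / 2) * St q - Rt q + lambda1 \<gamma> (S q) (R q) * ((1 + e / 2) * Sx q - Rx q)"
      using m good[OF q] by (simp add: m1_def)
  next
    fix q assume "q \<in> {l..X} \<times> {0..T}" "fst q = l \<or> snd q = 0"
    then show "0 \<le> (1 + e / 2) * S q - R q"
      using data[of q] rectangle_subset[OF X, of T] by (auto simp: algebra_simps)
  qed (rule p)
  then show ?thesis by (simp add: algebra_simps)
qed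

text \<open>Along a characteristic of speed \<open>lambda1\<close> the gap satisfies a linear homogeneous equation with bounded
coefficient \<open>c\<close>, so it is bounded below by a decaying exponential.\<close>

lemma gap_positive:
  assumes X: "X \<in> I" and p: "p \<in> {l..X} \<times> {0..T}"
    and good: "\<And>p. p \<in> {l..X} \<times> {0..T} \<Longrightarrow> 0 \<le> S p \<and> S p \<le> R p"
  shows "S p < R p"
proof -
  let ?K = "{l..X} \<times> {0..T}"
  note cont = continuous_on_rectangle[OF X, of T] continuous_on_k_fst[OF X, of T]
  have K: "compact ?K" by (intro compact_Times compact_Icc)
  define c where "c q = - (\<gamma> - 1) / 4 * k (fst q) * (R q + S q) - (\<gamma> - 1) / 2 * Rx q" for q
  have "continuous_on ?K c" unfolding c_def by (intro continuous_intros cont)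
  then obtain L where L: "\<And>q. q \<in> ?K \<Longrightarrow> \<bar>c q\<bar> \<le> L"
    using continuous_on_compact_bounded_abs[OF K] by blast
  have "0 \<le> L" using L[OF p] by simp
  have "continuous_on ?K (\<lambda>p. R p - S p)" by (intro continuous_intros cont)
  then obtain m where m: "0 < m" "\<And>q. q \<in> ?K \<Longrightarrow> fst q = l \<or> snd q = 0 \<Longrightarrow> m \<le> R q - S q"
    using boundary_positive_bound[OF X, of T "\<lambda>p. R p - S p"] data rectangle_subset[OF X, of T]
    by (smt (verit, best) subsetD)
  define E where "E q = m * exp (- L * snd q)" for q :: "real \<times> real"
  have E: "0 < E q" for q using m by (simp add: E_def)
  have "0 \<le> R p - S p - E p"
  proof (rule transport_min_principle[of l X T "\<lambda>p. R p - S p - E p" "\<lambda>p. Rx p - Sx p"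
        "\<lambda>p. Rt p - St p + L * E p" "\<lambda>p. lambda1 \<gamma> (S p) (R p)" c L])
    show "has_partials ?K (\<lambda>p. R p - S p - E p) (\<lambda>p. Rx p - Sx p) (\<lambda>p. Rt p - St p + L * E p)"
      using has_partials_subset[OF S(1) rectangle_subset[OF X, of T]]
        has_partials_subset[OF R(1) rectangle_subset[OF X, of T]]
      unfolding has_partials_def E_def
      by (auto intro!: derivative_eq_intros simp: fun_eq_iff algebra_simps)
    fix q assume q: "q \<in> ?K"
    then have q': "q \<in> I \<times> {0..}" using rectangle_subset[OF X] by blast
    have St: "St q = source \<gamma> (k (fst q)) (S q) (R q) - lambda1 \<gamma> (S q) (R q) * Sx q"
      and Rt: "Rt q = - source \<gamma> (k (fst q)) (S q) (R q) - lambda2 \<gamma> (S q) (R q) * Rx q"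
      using pde[OF q'] by auto
    have "Rt q - St q + L * E q + lambda1 \<gamma> (S q) (R q) * (Rx q - Sx q)
        = c q * (R q - S q - E q) + (c q + L) * E q"
      unfolding St Rt c_def source_def lambda1_def lambda2_def
      by (simp add: field_simps power2_eq_square)
    moreover have "0 \<le> (c q + L) * E q"
      using L[OF q] E[of q] by (intro mult_nonneg_nonneg) auto
    ultimately have "c q * (R q - S q - E q)
        \<le> Rt q - St q + L * E q + lambda1 \<gamma> (S q) (R q) * (Rx q - Sx q)" by linarith
    then show "0 \<le> lambda1 \<gamma> (S q) (R q) \<and> \<bar>c q\<bar> \<le> L \<and> c q * (R q - S q - E q)
        \<le> Rt q - St q + L * E q + lambda1 \<gamma> (S q) (R q) * (Rx q - Sx q)"
      using L[OF q] good[OF q] gamma lambda1_ge[of \<gamma> "S q" "R q"] by auto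
  next
    fix q assume q: "q \<in> ?K" "fst q = l \<or> snd q = 0"
    have "E q \<le> m" using m q(1) \<open>0 \<le> L\<close> by (auto simp: E_def mult_le_cancel_left1)
    then show "0 \<le> R q - S q - E q" using m(2)[OF q] by simp
  qed (rule p)
  then show ?thesis using E[of p] by simp
qed

text \<open>Continuation: at the first time \<open>t0\<close> at which one of the inequalities fails somewhere on the rectangle,
they still hold in weak form, and the previous lemmas turn the weak form into the strict one.\<close>

lemma gap_invariant:
  assumes X: "X \<in> I" and p: "p \<in> {l..X} \<times> {0..T}"
  shows "0 < S p \<and> S p < R p \<and> R p - S p < e * S p"
proof (rule ccontr)
  assume bad: "\<not> ?thesis"
  let ?K = "{l..X} \<times> {0..T}"
  define f where "f q = min (S q) (min (R q - S q) (e * S q - (R q - S q)))" for q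
  have f_pos: "0 < f q \<longleftrightarrow> 0 < S q \<and> S q < R q \<and> R q - S q < e * S q"
    and f_nonneg: "0 \<le> f q \<longleftrightarrow> 0 \<le> S q \<and> S q \<le> R q \<and> R q - S q \<le> e * S q" for q
    by (auto simp: f_def)
  have bdry: "0 < f q" if "q \<in> ?K" "fst q = l \<or> snd q = 0" for q
  proof -
    have "q \<in> I \<times> {0..}" using that rectangle_subset[OF X] by blast
    then have "0 < S q \<and> S q < R q \<and> R q - S q \<le> e / 2 * S q" using data that(2) by blast
    moreover from this have "0 < e / 2 * S q" using e by simp
    ultimately show ?thesis unfolding f_pos by linarith
  qed
  have cont: "continuous_on ?K f"
    unfolding f_def by (intro continuous_intros continuous_on_rectangle X)
  define B where "B = ?K \<inter> f -` {..0}"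
  have "closed B" unfolding B_def
    by (intro continuous_closed_preimage cont closed_Times closed_atLeastAtMost closed_atMost)
  then have "compact B"
    unfolding B_def by (metis Int_left_absorb compact_Icc compact_Int_closed compact_Times)
  moreover have "p \<in> B" using bad p f_pos[of p] by (auto simp: B_def)
  moreover have "continuous_on B snd" by (intro continuous_intros)
  ultimately obtain p0 where p0: "p0 \<in> B" "\<And>q. q \<in> B \<Longrightarrow> snd p0 \<le> snd q"
    using continuous_attains_inf[of B snd] by blast
  define t0 where "t0 = snd p0"
  have t0: "0 < t0" "t0 \<le> T" using p0(1) bdry[of p0] by (auto simp: B_def t0_def less_le)
  have before: "0 < f q" if "q \<in> ?K" "snd q < t0" for q
    using p0(2)[of q] that by (force simp: B_def t0_def)
  have upto: "0 \<le> f q" if q: "q \<in> {l..X} \<times> {0..t0}" for q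
  proof (cases "snd q < t0")
    case True
    then show ?thesis using before[of q] q t0 by auto
  next
    case False
    then have q0: "q = (fst q, t0)" using q by auto
    have "continuous_on {0..t0} (\<lambda>s. f (fst q, s))"
      by (rule continuous_on_compose2[OF cont]) (use q t0 in \<open>auto intro!: continuous_intros\<close>)
    then have "((\<lambda>s. f (fst q, s)) \<longlongrightarrow> f (fst q, t0)) (at_left t0)"
      using t0 by (rule_tac continuous_on_Icc_at_leftD)
    moreover have "\<forall>\<^sub>F s in at_left t0. 0 \<le> f (fst q, s)"
      using eventually_at_left_real[OF t0(1)]
      by eventually_elim (use before q t0 in \<open>auto intro!: less_imp_le\<close>)
    ultimately have "0 \<le> f (fst q, t0)"
      by (rule tendsto_lowerbound) (simp add: trivial_limit_at_left_real)
    then show ?thesis using q0 by simp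
  qed
  let ?K0 = "{l..X} \<times> {0..t0}"
  have p00: "p0 \<in> ?K0" using p0(1) by (auto simp: B_def t0_def)
  have nn: "0 \<le> S q \<and> S q \<le> R q" and le: "R q - S q \<le> e * S q" if "q \<in> ?K0" for q
    using upto[OF that] unfolding f_nonneg by auto
  obtain m where m: "0 < m" "\<And>q. q \<in> ?K0 \<Longrightarrow> fst q = l \<or> snd q = 0 \<Longrightarrow> m \<le> S q"
    using boundary_positive_bound[OF X, of t0 S] continuous_on_rectangle(1)[OF X, of t0] data
      rectangle_subset[OF X, of t0] by (smt (verit, best) subsetD)
  have S_pos: "0 < S q" if "q \<in> ?K0" for q
    using S_ge_of_boundary[OF X that nn m(2)] m(1) by linarith
  have "R p0 - S p0 \<le> e / 2 * S p0"
    by (rule gap_le_of_boundary[OF X p00]) (use S_pos nn le in auto)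
  moreover have "0 < e / 2 * S p0" using e S_pos[OF p00] by simp
  moreover have "S p0 < R p0" by (rule gap_positive[OF X p00 nn])
  ultimately have "0 < f p0" unfolding f_pos using S_pos[OF p00] by linarith
  then show False using p0(1) by (simp add: B_def)
qed

lemma solution_bounds:
  assumes p: "p \<in> I \<times> {0..}"
  shows "0 < S p" "S p < R p" "R p \<le> 2 * S p" "a * k (fst p) * (S p)\<^sup>2 \<le> - St p" "Rt p \<le> 0"
proof -
  have X: "fst p \<in> I" and p': "p \<in> {l..fst p} \<times> {0..snd p}" using p I by (auto simp: mem_Times_iff)
  note g = gap_invariant[OF X]
  show 1: "0 < S p" "S p < R p" using g[OF p'] by auto
  have "e * S p \<le> 1 * S p" using e 1 by (intro mult_right_mono) auto
  then show "R p \<le> 2 * S p" using g[OF p'] by linarith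
  have "0 \<le> decay_margin p \<and> 0 \<le> - Rt p"
    by (rule time_derivatives_signed[OF X _ p']) (use g in \<open>auto intro: less_imp_le\<close>)
  then show "a * k (fst p) * (S p)\<^sup>2 \<le> - St p" "Rt p \<le> 0" by (auto simp: decay_margin_def)
qed

section \<open>Monotonicity in time and decay\<close>

lemma S_antimono:
  assumes "x \<in> I" "0 \<le> s" "s \<le> t"
  shows "S (x, t) \<le> S (x, s)"
proof -
  have "- S (x, s) \<le> - S (x, t)"
  proof (rule nonneg_derivative_imp_le[OF \<open>s \<le> t\<close>])
    fix r assume r: "s \<le> r" "r \<le> t"
    show "((\<lambda>r. - S (x, r)) has_real_derivative - St (x, r)) (at r within {s..t})"
      by (intro DERIV_minus has_partials_D2[OF S(1)]) (use assms r in auto)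
    have "0 \<le> a * k x * (S (x, r))\<^sup>2" using a_pos k(1) assms by simp
    then show "0 \<le> - St (x, r)" using solution_bounds(4)[of "(x, r)"] assms r by simp
  qed
  then show ?thesis by simp
qed

lemma R_antimono:
  assumes "x \<in> I" "0 \<le> s" "s \<le> t"
  shows "R (x, t) \<le> R (x, s)"
proof -
  have "- R (x, s) \<le> - R (x, t)"
  proof (rule nonneg_derivative_imp_le[OF \<open>s \<le> t\<close>])
    fix r assume r: "s \<le> r" "r \<le> t"
    show "((\<lambda>r. - R (x, r)) has_real_derivative - Rt (x, r)) (at r within {s..t})"
      by (intro DERIV_minus has_partials_D2[OF R(1)]) (use assms r in auto)
    show "0 \<le> - Rt (x, r)" using solution_bounds(5)[of "(x, r)"] assms r by simp
  qed
  then show ?thesis by simp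
qed

text \<open>The function \<open>1 / S - a k t\<close> is nondecreasing in time.\<close>

lemma S_decay:
  assumes x: "x \<in> I" and t: "0 \<le> t"
  shows "a * k x * t * S (x, t) \<le> 1"
proof -
  \<comment> \<open>The value at time \<open>0\<close> is positive and may be dropped.\<close>
  have "1 / S (x, 0) - a * k x * 0 \<le> 1 / S (x, t) - a * k x * t"
  proof (rule nonneg_derivative_imp_le[OF t])
    fix r assume r: "0 \<le> r" "r \<le> t"
    note b = solution_bounds[of "(x, r)"]
    show "((\<lambda>r. 1 / S (x, r) - a * k x * r) has_real_derivative
        - St (x, r) / (S (x, r))\<^sup>2 - a * k x) (at r within {0..t})"
      using has_partials_D2[OF S(1), of x r "{0..t}"] b x r
      by (auto intro!: derivative_eq_intros simp: power2_eq_square)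
    have "a * k x \<le> - St (x, r) / (S (x, r))\<^sup>2"
      using b x r by (subst pos_le_divide_eq) auto
    then show "0 \<le> - St (x, r) / (S (x, r))\<^sup>2 - a * k x" by simp
  qed
  then have "a * k x * t \<le> 1 / S (x, t)"
    using solution_bounds(1)[of "(x, 0)"] x by (smt (verit) divide_pos_pos atLeast_iff mem_Sigma_iff mult_zero_right)
  then show ?thesis using solution_bounds(1)[of "(x, t)"] x t by (simp add: pos_le_divide_eq)
qed

lemma k_antimono:
  assumes "x1 \<in> I" "l \<le> x" "x \<le> x1"
  shows "k x1 \<le> k x"
proof -
  have sub: "{x..x1} \<subseteq> I" using I[OF assms(1)] assms by auto
  have "- k x \<le> - k x1"
  proof (rule nonneg_derivative_imp_le[OF \<open>x \<le> x1\<close>])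
    fix y assume "x \<le> y" "y \<le> x1"
    then have y: "y \<in> I" using sub by auto
    show "((\<lambda>y. - k y) has_real_derivative - k' y) (at y within {x..x1})"
      by (intro DERIV_minus DERIV_subset[OF k(2)[OF y] sub])
    have "0 \<le> 2 * a * (k y)\<^sup>2" using a_pos by simp
    then show "0 \<le> - k' y" using k(3)[OF y] by linarith
  qed
  then show ?thesis by simp
qed

end

section \<open>Traces of a classical solution\<close>

text \<open>Transfers the differential equations, which are postulated in the open set, to the sides
\<open>x = x\<^sub>B\<close> and \<open>t = 0\<close>.\<close>

lemma eq_on_closure_of_interior:
  fixes F :: "real \<times> real \<Rightarrow> real"
  assumes I: "(\<exists>xC>xB. I = {xB..xC}) \<or> I = {xB..}"
    and F: "continuous_on (I \<times> {0..}) F"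
    and eq: "\<And>x t. x \<in> interior I \<Longrightarrow> 0 < t \<Longrightarrow> F (x, t) = 0"
    and p: "p \<in> I \<times> {0..}"
  shows "F p = 0"
proof -
  have "closure (interior I) = I"
    using I by (auto simp: interior_atLeastAtMost_real)
  then have cl: "closure (interior I \<times> {0<..}) = I \<times> {0::real..}" by (simp add: closure_Times)
  show ?thesis
    by (rule continuous_constant_on_closure[of "interior I \<times> {0<..}"])
      (use cl F eq p in auto)
qed

lemma deriv_in_eq:
  assumes "connected A" "x \<in> A" "y \<in> A" "x \<noteq> y"
    and f: "(f has_real_derivative d) (at x within A)" and eq: "\<And>z. z \<in> A \<Longrightarrow> g z = f z"
  shows "deriv_in A g x = d"
proof -
  have "x islimpt A" using connected_imp_perfect[of A x] assms by blast
  then have "at x within A \<noteq> bot" by (simp add: trivial_limit_within)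
  moreover have "(g has_vector_derivative d) (at x within A)"
    using has_vector_derivative_transform[OF assms(2) eq] f
    by (simp add: has_real_derivative_iff_has_vector_derivative)
  ultimately show ?thesis by (rule vector_derivative_within)
qed

lemma C1_on_xt_has_partials:
  assumes "C1_on_xt D F"
  obtains Fx Ft where "has_partials D (case_prod F) Fx Ft" "continuous_on D Fx" "continuous_on D Ft"
  using assms unfolding C1_on_xt_def has_partials_def case_prod_unfold by blast

text \<open>The derivatives of the data are the traces of the partial derivatives of the solution; together with
the equations on the closed set, this determines \<open>S\<^sub>t\<close> and \<open>R\<^sub>t\<close> at \<open>t = 0\<close>, where the data prescribe
only \<open>S\<^sub>x\<close> and \<open>R\<^sub>x\<close>.\<close>

lemma global_C1_solution_partials:
  assumes I: "(\<exists>xC>xB. I = {xB..xC}) \<or> I = {xB..}"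
    and k: "continuous_on I k"
    and sol: "global_C1_solution \<gamma> I xB k s0 r0 sB rB S R"
  obtains Sx St Rx Rt where
    "has_partials (I \<times> {0..}) (case_prod S) Sx St" "continuous_on (I \<times> {0..}) Sx" "continuous_on (I \<times> {0..}) St"
    "has_partials (I \<times> {0..}) (case_prod R) Rx Rt" "continuous_on (I \<times> {0..}) Rx" "continuous_on (I \<times> {0..}) Rt"
    "\<And>p. p \<in> I \<times> {0..} \<Longrightarrow> St p + lambda1 \<gamma> (case_prod S p) (case_prod R p) * Sx p
       = source \<gamma> (k (fst p)) (case_prod S p) (case_prod R p)"
    "\<And>p. p \<in> I \<times> {0..} \<Longrightarrow> Rt p + lambda2 \<gamma> (case_prod S p) (case_prod R p) * Rx p
       = - source \<gamma> (k (fst p)) (case_prod S p) (case_prod R p)"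
    "\<And>x. x \<in> I \<Longrightarrow> Sx (x, 0) = deriv_in I s0 x" "\<And>x. x \<in> I \<Longrightarrow> Rx (x, 0) = deriv_in I r0 x"
    "\<And>t. 0 \<le> t \<Longrightarrow> St (xB, t) = deriv_in {0..} sB t" "\<And>t. 0 \<le> t \<Longrightarrow> Rt (xB, t) = deriv_in {0..} rB t"
proof -
  let ?D = "I \<times> {0::real..}"
  let ?S = "case_prod S" and ?R = "case_prod R"
  obtain Sx St where S: "has_partials ?D ?S Sx St" "continuous_on ?D Sx" "continuous_on ?D St"
    using sol C1_on_xt_has_partials unfolding global_C1_solution_def by blast
  obtain Rx Rt where R: "has_partials ?D ?R Rx Rt" "continuous_on ?D Rx" "continuous_on ?D Rt"
    using sol C1_on_xt_has_partials unfolding global_C1_solution_def by blast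
  have deriv: "deriv (\<lambda>\<tau>. F x \<tau>) t = Ft (x, t) \<and> deriv (\<lambda>y. F y t) x = Fx (x, t)"
    if F: "has_partials ?D (case_prod F) Fx Ft" and x: "x \<in> interior I" "0 < t" for F Fx Ft x t
  proof -
    have xI: "x \<in> I" using x interior_subset by blast
    have "(F x has_real_derivative Ft (x, t)) (at t within {0..})"
      using has_partials_D2[OF F, of x t "{0..}"] xI x by simp
    moreover have "at t within {0..} = at t" using x by (intro at_within_interior) auto
    moreover have "((\<lambda>y. F y t) has_real_derivative Fx (x, t)) (at x within I)"
      using has_partials_D1[OF F, of x t I] xI x by simp
    moreover have "at x within I = at x" using x by (intro at_within_interior)
    ultimately show ?thesis by (auto intro: DERIV_imp_deriv)
  qed
  have kc: "continuous_on ?D (\<lambda>p. k (fst p))"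
    by (rule continuous_on_compose2[OF k]) (auto intro!: continuous_intros)
  note cont = kc S(2,3) R(2,3) has_partials_continuous_on[OF S(1)] has_partials_continuous_on[OF R(1)]
  have pde1: "St p + lambda1 \<gamma> (?S p) (?R p) * Sx p - source \<gamma> (k (fst p)) (?S p) (?R p) = 0"
    if "p \<in> ?D" for p
  proof (rule eq_on_closure_of_interior[OF I _ _ that])
    show "continuous_on ?D (\<lambda>p. St p + lambda1 \<gamma> (?S p) (?R p) * Sx p - source \<gamma> (k (fst p)) (?S p) (?R p))"
      unfolding lambda1_def source_def by (intro continuous_intros cont)
    show "St (x, t) + lambda1 \<gamma> (?S (x, t)) (?R (x, t)) * Sx (x, t)
        - source \<gamma> (k (fst (x, t))) (?S (x, t)) (?R (x, t)) = 0" if "x \<in> interior I" "0 < t" for x t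
    proof -
      have "deriv (\<lambda>\<tau>. S x \<tau>) t + lambda1 \<gamma> (S x t) (R x t) * deriv (\<lambda>y. S y t) x
          = source \<gamma> (k x) (S x t) (R x t)"
        using sol that unfolding global_C1_solution_def by blast
      then show ?thesis unfolding deriv[OF S(1) that, THEN conjunct1] deriv[OF S(1) that, THEN conjunct2] by simp
    qed
  qed
  have pde2: "Rt p + lambda2 \<gamma> (?S p) (?R p) * Rx p + source \<gamma> (k (fst p)) (?S p) (?R p) = 0"
    if "p \<in> ?D" for p
  proof (rule eq_on_closure_of_interior[OF I _ _ that])
    show "continuous_on ?D (\<lambda>p. Rt p + lambda2 \<gamma> (?S p) (?R p) * Rx p + source \<gamma> (k (fst p)) (?S p) (?R p))"
      unfolding lambda2_def source_def by (intro continuous_intros cont)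
    show "Rt (x, t) + lambda2 \<gamma> (?S (x, t)) (?R (x, t)) * Rx (x, t)
        + source \<gamma> (k (fst (x, t))) (?S (x, t)) (?R (x, t)) = 0" if "x \<in> interior I" "0 < t" for x t
    proof -
      have "deriv (\<lambda>\<tau>. R x \<tau>) t + lambda2 \<gamma> (S x t) (R x t) * deriv (\<lambda>y. R y t) x
          = - source \<gamma> (k x) (S x t) (R x t)"
        using sol that unfolding global_C1_solution_def by blast
      then show ?thesis unfolding deriv[OF R(1) that, THEN conjunct1] deriv[OF R(1) that, THEN conjunct2] by simp
    qed
  qed
  have init: "Fx (x, 0) = deriv_in I f0 x"
    if F: "has_partials ?D (case_prod F) Fx Ft" and x: "x \<in> I" and f0: "\<And>x. x \<in> I \<Longrightarrow> F x 0 = f0 x" for F Fx Ft f0 x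
  proof -
    obtain y where "y \<in> I" "x \<noteq> y"
    proof -
      from I have "xB \<in> I" "\<exists>z\<in>I. z \<noteq> xB" by (auto intro: exI[of _ "xB + 1"] bexI[of _ "xB + 1"])
      then show ?thesis using that by metis
    qed
    moreover have "connected I" using I by (auto simp: is_interval_connected)
    ultimately show ?thesis
      using deriv_in_eq[of I x y "\<lambda>x. F x 0" "Fx (x, 0)" f0] has_partials_D1[OF F, of x 0 I] x f0 by auto
  qed
  have bdry: "Ft (xB, t) = deriv_in {0..} fB t"
    if F: "has_partials ?D (case_prod F) Fx Ft" and t: "0 \<le> t" and fB: "\<And>t. 0 \<le> t \<Longrightarrow> F xB t = fB t" for F Fx Ft fB t
  proof -
    have "xB \<in> I" using I by auto
    then show ?thesis
      using deriv_in_eq[of "{0..}" t "t + 1" "\<lambda>t. F xB t" "Ft (xB, t)" fB]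
        has_partials_D2[OF F, of xB t "{0..}"] t fB by (auto simp: is_interval_connected)
  qed
  show thesis
    by (rule that[OF S R]) (use pde1 pde2[THEN eq_neg_iff_add_eq_0[THEN iffD2]] init[OF S(1)] init[OF R(1)] bdry[OF S(1)] bdry[OF R(1)] sol
        in \<open>auto simp: global_C1_solution_def\<close>)
qed

section \<open>Admissible data\<close>

text \<open>By the equation, \<open>- S\<^sub>t = lambda1 S\<^sub>x - g\<close> at \<open>t = 0\<close>.  To leading order in \<open>\<xi>\<close> the hypothesis gives
\<open>2 a \<kappa> s\<^sup>2\<close> for the right-hand side, twice what is needed.\<close>

lemma initial_decay_margin_nonneg:
  assumes "1 < \<gamma>" "\<gamma> < 3" and \<kappa>: "0 \<le> \<kappa>" and s: "0 < s" "s < r"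
    and \<xi>: "r - s = \<xi> * s" "\<xi> \<le> 1" "\<xi> * (\<bar>c\<bar> + 1) \<le> a" and ds: "0 \<le> ds" "\<kappa> * s / 2 * (4 * a - c * \<xi>) \<le> ds"
  shows "a * \<kappa> * s\<^sup>2 \<le> lambda1 \<gamma> s r * ds - source \<gamma> \<kappa> s r"
proof -
  have "0 < \<xi> * s" using s \<xi>(1) by linarith
  then have \<xi>0: "0 \<le> \<xi>" using s by (simp add: zero_less_mult_iff)
  have "source \<gamma> \<kappa> s r \<le> \<xi> * \<kappa> * s\<^sup>2" using source_le[of \<gamma> \<kappa> s r \<xi>] assms by simp
  moreover have "s * (\<kappa> * s / 2 * (4 * a - c * \<xi>)) \<le> lambda1 \<gamma> s r * ds"
  proof -
    have "s * (\<kappa> * s / 2 * (4 * a - c * \<xi>)) \<le> s * ds" using s ds by (intro mult_left_mono) auto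
    also have "\<dots> \<le> lambda1 \<gamma> s r * ds" using lambda1_ge[of \<gamma> s r] assms by (intro mult_right_mono) auto
    finally show ?thesis .
  qed
  moreover have "s * (\<kappa> * s / 2 * (4 * a - c * \<xi>)) - \<xi> * \<kappa> * s\<^sup>2 = \<kappa> * s\<^sup>2 * (2 * a - c * \<xi> / 2 - \<xi>)"
    by (simp add: field_simps power2_eq_square)
  moreover have "\<kappa> * s\<^sup>2 * a \<le> \<kappa> * s\<^sup>2 * (2 * a - c * \<xi> / 2 - \<xi>)"
  proof (rule mult_left_mono)
    have "c * \<xi> \<le> \<bar>c\<bar> * \<xi>" "0 \<le> \<bar>c\<bar> * \<xi>" using \<xi>0 by (auto intro: mult_right_mono)
    then show "a \<le> 2 * a - c * \<xi> / 2 - \<xi>" using \<xi>(3) by (simp add: algebra_simps)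
  qed (use \<kappa> in simp)
  ultimately show ?thesis by (simp add: algebra_simps)
qed

text \<open>Again the leading term \<open>- 2 a \<kappa> s\<^sup>2\<close> of the bound on \<open>ds\<close> is twice what is needed.\<close>

lemma boundary_decay_margin_nonneg:
  fixes a :: real
  assumes \<kappa>: "0 \<le> \<kappa>" and \<xi>: "0 \<le> \<xi>" "\<xi> \<le> 1" "\<xi> * (\<bar>c\<bar> + \<bar>d\<bar>) \<le> a" and "0 < a"
    and ds: "ds \<le> \<kappa> * s\<^sup>2 / 2 * (- 4 * a + c * \<xi> + d * \<xi>\<^sup>2)"
  shows "a * \<kappa> * s\<^sup>2 \<le> - ds"
proof -
  have "\<xi>\<^sup>2 \<le> \<xi>" using \<xi> by (simp add: power2_eq_square mult_left_le_one_le)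
  then have "d * \<xi>\<^sup>2 \<le> \<bar>d\<bar> * \<xi>"
    by (meson abs_ge_self abs_ge_zero mult_mono order_trans mult_left_mono mult_right_mono zero_le_power2)
  moreover have "c * \<xi> \<le> \<bar>c\<bar> * \<xi>" using \<xi> by (auto intro: mult_right_mono)
  ultimately have "- 4 * a + c * \<xi> + d * \<xi>\<^sup>2 \<le> - 2 * a" using \<xi>(3) \<open>0 < a\<close> by (simp add: algebra_simps)
  then have "\<kappa> * s\<^sup>2 / 2 * (- 4 * a + c * \<xi> + d * \<xi>\<^sup>2) \<le> \<kappa> * s\<^sup>2 / 2 * (- 2 * a)"
    using \<kappa> by (intro mult_left_mono) auto
  then show ?thesis using ds by (simp add: algebra_simps)
qed

text \<open>Here \<open>z\<close> bounds \<open>\<xi>\<close>, and \<open>c\<close>, \<open>d\<close> are the coefficients of \<open>\<xi>\<close> and \<open>\<xi>\<^sup>2\<close> in the conditions on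
\<open>S\<^sub>0'\<close> and \<open>S\<^sub>B'\<close>.  The resonant case \<open>b = -1\<close> fits the same form with \<open>c = 0\<close> and \<open>d = 1 / 6\<close>:
division by zero gives \<open>c = 0\<close>, and since \<open>S \<xi> \<le> M z \<le> 1\<close> makes \<open>\<epsilon>\<close> nonpositive, the terms
containing \<open>\<epsilon>\<close> only strengthen the conditions.\<close>

lemma duct_flow_of_solution:
  fixes S R :: "real \<Rightarrow> real \<Rightarrow> real" and s0 r0 sB rB :: "real \<Rightarrow> real"
  assumes a_def: "a = (\<gamma> - 1) / (2 * (3 - \<gamma>))" and c_def: "c = 1 / (b_const \<gamma> + 1)"
    and d_def: "d = (if b_const \<gamma> = -1 then 1 / 6
          else (1 - b_const \<gamma>) / (2 * (b_const \<gamma> + 1) * (1 - 2 * b_const \<gamma>)))"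
    and gamma: "1 < \<gamma>" "\<gamma> < 3"
    and I: "(\<exists>xC>xB. I = {xB..xC}) \<or> I = {xB..}"
    and k: "cond_A1 I k" and \<delta>: "0 < \<delta>" "\<delta> < 2"
    and k': "\<forall>x\<in>I. deriv_in I k x \<le> (k x)\<^sup>2 / ((2 - \<delta>) * b_const \<gamma>)"
    and e: "0 < e" "e \<le> 1" "e \<le> a" "24 * (3 - \<gamma>) * e \<le> \<gamma>\<^sup>2 - 1"
    and z: "z \<le> e / 2" "z * (\<bar>c\<bar> + \<bar>d\<bar> + 1) \<le> a" "M0 * z \<le> 1" "MB * z \<le> 1" "C * sqrt \<nu> \<le> z"
    and A34: "cond_A34 I M0 s0 r0" "cond_A34 {0..} MB sB rB"
    and A5: "cond_A5 I C \<nu> s0 r0 sB rB"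
    and init: "cond_initial \<gamma> I k s0 r0" and bdry: "cond_boundary \<gamma> xB k sB rB"
    and sol: "global_C1_solution \<gamma> I xB k s0 r0 sB rB S R"
  shows "\<exists>Sx St Rx Rt. duct_flow \<gamma> a e xB I k (deriv_in I k) (case_prod S) Sx St (case_prod R) Rx Rt"
proof -
  let ?b = "b_const \<gamma>"
  have a: "0 < a" using gamma by (simp add: a_def)
  have b: "1 / ?b = - 4 * a" "1 / (- ?b) = 4 * a"
    using gamma by (simp_all add: a_def b_const_def field_simps)
  have I': "xB \<in> I" "\<And>x. x \<in> I \<Longrightarrow> xB \<le> x \<and> {xB..x} \<subseteq> I" using I by auto
  have k0: "0 \<le> k x" if "x \<in> I" for x using k that by (auto simp: cond_A1_def)
  have kd: "(k has_real_derivative deriv_in I k x) (at x within I)" if "x \<in> I" for x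
    using k that unfolding cond_A1_def C1_norm_le_def C1_on_def differentiable_on_def
    by (metis has_real_derivative_iff_has_vector_derivative vector_derivative_works)
  then have kc: "continuous_on I k" by (meson DERIV_continuous_on)
  have kle: "deriv_in I k x \<le> - 2 * a * (k x)\<^sup>2" if "x \<in> I" for x
  proof -
    have "(k x)\<^sup>2 / ((2 - \<delta>) * ?b) = (k x)\<^sup>2 / (2 - \<delta>) * (1 / ?b)" by simp
    also have "\<dots> = - (4 * a * ((k x)\<^sup>2 / (2 - \<delta>)))" unfolding b by simp
    also have "\<dots> \<le> - (4 * a * ((k x)\<^sup>2 / 2))"
      using \<delta> a by (intro le_imp_neg_le mult_left_mono divide_left_mono) auto
    finally show ?thesis using k' that by fastforce
  qed
  obtain Sx St Rx Rt where S: "has_partials (I \<times> {0..}) (case_prod S) Sx St"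
      "continuous_on (I \<times> {0..}) Sx" "continuous_on (I \<times> {0..}) St"
    and R: "has_partials (I \<times> {0..}) (case_prod R) Rx Rt"
      "continuous_on (I \<times> {0..}) Rx" "continuous_on (I \<times> {0..}) Rt"
    and pde: "\<And>p. p \<in> I \<times> {0..} \<Longrightarrow> St p + lambda1 \<gamma> (case_prod S p) (case_prod R p) * Sx p
         = source \<gamma> (k (fst p)) (case_prod S p) (case_prod R p)"
      "\<And>p. p \<in> I \<times> {0..} \<Longrightarrow> Rt p + lambda2 \<gamma> (case_prod S p) (case_prod R p) * Rx p
         = - source \<gamma> (k (fst p)) (case_prod S p) (case_prod R p)"
    and tr: "\<And>x. x \<in> I \<Longrightarrow> Sx (x, 0) = deriv_in I s0 x" "\<And>x. x \<in> I \<Longrightarrow> Rx (x, 0) = deriv_in I r0 x"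
      "\<And>t. 0 \<le> t \<Longrightarrow> St (xB, t) = deriv_in {0..} sB t" "\<And>t. 0 \<le> t \<Longrightarrow> Rt (xB, t) = deriv_in {0..} rB t"
    by (rule global_C1_solution_partials[OF I kc sol]) (rule that)
  have S0: "S x 0 = s0 x \<and> R x 0 = r0 x" if "x \<in> I" for x
    using sol that by (simp add: global_C1_solution_def)
  have SB: "S xB t = sB t \<and> R xB t = rB t" if "0 \<le> t" for t
    using sol that by (simp add: global_C1_solution_def)
  have ratio: "0 < xi s r y \<and> xi s r y \<le> z \<and> r y - s y = xi s r y * s y
      \<and> r y - s y \<le> e / 2 * s y \<and> eps s r y \<le> 0"
    if "cond_A34 A M s r" "y \<in> A" "\<bar>xi s r y\<bar> \<le> C * sqrt \<nu>" "M * z \<le> 1" for A M s r y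
  proof -
    have s: "0 < s y" "s y < r y" using that by (auto simp: cond_A34_def)
    have "s y \<le> M" using that unfolding cond_A34_def C1_norm_le_def by (smt (verit, best))
    have 1: "xi s r y \<le> z" using that z by linarith
    have 2: "0 < xi s r y" using s by (simp add: xi_def)
    have 3: "r y - s y = xi s r y * s y" using s by (simp add: xi_def field_simps)
    have "xi s r y * s y \<le> e / 2 * s y" using 1 z s by (intro mult_right_mono) auto
    moreover have "s y * xi s r y \<le> M * z"
      using 1 2 s \<open>s y \<le> M\<close> by (intro mult_mono) auto
    then have "eps s r y \<le> 0" using that(4) s 2 by (simp add: eps_def)
    ultimately show ?thesis using 1 2 3 by auto
  qed
  have small: "\<xi> \<le> 1 \<and> \<xi> * (\<bar>c\<bar> + 1) \<le> a \<and> \<xi> * (\<bar>c\<bar> + \<bar>d\<bar>) \<le> a" if "0 < \<xi>" "\<xi> \<le> z" for \<xi>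
  proof -
    have *: "\<xi> * u \<le> a" if "u \<le> \<bar>c\<bar> + \<bar>d\<bar> + 1" for u
    proof -
      have "\<xi> * u \<le> \<xi> * (\<bar>c\<bar> + \<bar>d\<bar> + 1)" using that \<open>0 < \<xi>\<close> by (intro mult_left_mono) auto
      also have "\<dots> \<le> z * (\<bar>c\<bar> + \<bar>d\<bar> + 1)" using \<open>\<xi> \<le> z\<close> by (intro mult_right_mono) auto
      finally show ?thesis using z(2) by simp
    qed
    show ?thesis using * that z e by auto
  qed
  have init_data: "0 < S x 0 \<and> S x 0 < R x 0 \<and> R x 0 - S x 0 \<le> e / 2 * S x 0
      \<and> a * k x * (S x 0)\<^sup>2 \<le> - St (x, 0) \<and> Rt (x, 0) \<le> 0" if x: "x \<in> I" for x
  proof -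
    define \<xi> where "\<xi> = xi s0 r0 x"
    have s: "0 < s0 x" "s0 x < r0 x" using A34(1) x by (auto simp: cond_A34_def)
    have A5x: "0 \<le> deriv_in I s0 x" "0 \<le> deriv_in I r0 x" "\<bar>xi s0 r0 x\<bar> \<le> C * sqrt \<nu>"
      using A5 x by (auto simp: cond_A5_def)
    note rt = ratio[OF A34(1) x A5x(3) z(3), folded \<xi>_def]
    then have rt': "r0 x - s0 x \<le> e / 2 * s0 x" by blast
    have "k x * s0 x / 2 * (4 * a - c * \<xi>) \<le> deriv_in I s0 x"
    proof (cases "?b = -1")
      case False
      then have "k x * s0 x / 2 * (1 / (- ?b) - 1 / (?b + 1) * \<xi>) \<le> deriv_in I s0 x"
        using init x unfolding cond_initial_def Let_def \<xi>_def by blast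
      then show ?thesis unfolding b(2) c_def .
    next
      case True
      then have "k x * s0 x / 2 * (1 - eps s0 r0 x * \<xi>) \<le> deriv_in I s0 x"
        using init x unfolding cond_initial_def Let_def \<xi>_def by blast
      moreover have "eps s0 r0 x * \<xi> \<le> 0" using rt by (simp add: mult_nonpos_nonneg)
      then have "k x * s0 x / 2 * 1 \<le> k x * s0 x / 2 * (1 - eps s0 r0 x * \<xi>)"
        using k0[OF x] s by (intro mult_left_mono) auto
      moreover have "4 * a = 1" "c = 0" using True b(2) by (simp_all add: c_def)
      ultimately show ?thesis by simp
    qed
    then have "a * k x * (s0 x)\<^sup>2 \<le> lambda1 \<gamma> (s0 x) (r0 x) * deriv_in I s0 x - source \<gamma> (k x) (s0 x) (r0 x)"
      using initial_decay_margin_nonneg[OF gamma k0[OF x] s, of \<xi> c a] rt small[of \<xi>] A5x(1) by blast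
    moreover have "0 \<le> lambda2 \<gamma> (s0 x) (r0 x) * deriv_in I r0 x"
      using lambda2_ge[of \<gamma> "s0 x" "r0 x"] gamma s A5x(2) by (intro mult_nonneg_nonneg) auto
    moreover have "0 \<le> source \<gamma> (k x) (s0 x) (r0 x)"
      using gamma s k0[OF x] by (intro source_nonneg) auto
    ultimately show ?thesis
      using pde[of "(x, 0)"] S0[OF x] tr(1,2)[OF x] x s rt' by auto
  qed
  have bdry_data: "0 < S xB t \<and> S xB t < R xB t \<and> R xB t - S xB t \<le> e / 2 * S xB t
      \<and> a * k xB * (S xB t)\<^sup>2 \<le> - St (xB, t) \<and> Rt (xB, t) \<le> 0" if t: "0 \<le> t" for t
  proof -
    define \<xi> where "\<xi> = xi sB rB t"
    have s: "0 < sB t" "sB t < rB t" using A34(2) t by (auto simp: cond_A34_def)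
    have A5t: "deriv_in {0..} rB t \<le> 0" "\<bar>xi sB rB t\<bar> \<le> C * sqrt \<nu>"
      using A5 t by (auto simp: cond_A5_def)
    have "t \<in> {0..}" using t by simp
    note rt = ratio[OF A34(2) this A5t(2) z(4), folded \<xi>_def]
    then have rt': "rB t - sB t \<le> e / 2 * sB t" by blast
    have "deriv_in {0..} sB t \<le> k xB * (sB t)\<^sup>2 / 2 * (- 4 * a + c * \<xi> + d * \<xi>\<^sup>2)"
    proof (cases "?b = -1")
      case False
      then have "deriv_in {0..} sB t \<le> k xB * (sB t)\<^sup>2 / 2 * (1 / ?b + 1 / (?b + 1) * \<xi>
          + (1 - ?b) / (2 * (?b + 1) * (1 - 2 * ?b)) * \<xi>\<^sup>2)"
        using bdry t unfolding cond_boundary_def Let_def \<xi>_def by blast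
      then show ?thesis using False unfolding b(1) by (simp add: c_def d_def)
    next
      case True
      define \<epsilon> where "\<epsilon> = eps sB rB t"
      have "deriv_in {0..} sB t \<le> k xB * (sB t)\<^sup>2 / 2 * (-1 + \<epsilon> * \<xi> + (2 * \<epsilon> + 1) / 6 * \<xi>\<^sup>2)"
        using bdry t True unfolding cond_boundary_def Let_def \<xi>_def \<epsilon>_def by blast
      also have "\<dots> \<le> k xB * (sB t)\<^sup>2 / 2 * (-1 + 1 / 6 * \<xi>\<^sup>2)"
      proof (rule mult_left_mono)
        have "\<epsilon> * \<xi> \<le> 0" "\<epsilon> * \<xi>\<^sup>2 \<le> 0" using rt by (simp_all add: \<epsilon>_def mult_nonpos_nonneg)
        then show "-1 + \<epsilon> * \<xi> + (2 * \<epsilon> + 1) / 6 * \<xi>\<^sup>2 \<le> -1 + 1 / 6 * \<xi>\<^sup>2"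
          by (simp add: field_simps)
      qed (use k0[OF I'(1)] in simp)
      also have "-1 + 1 / 6 * \<xi>\<^sup>2 = - 4 * a + c * \<xi> + d * \<xi>\<^sup>2"
      proof -
        have "4 * a = 1" using True b(2) by simp
        then show ?thesis using True by (simp add: c_def d_def)
      qed
      finally show ?thesis .
    qed
    then have "a * k xB * (sB t)\<^sup>2 \<le> - deriv_in {0..} sB t"
      using boundary_decay_margin_nonneg[OF k0[OF I'(1)], of \<xi> c d a] rt small[of \<xi>] a by force
    then show ?thesis using SB[OF t] tr(3,4)[OF t] s rt' A5t by simp
  qed
  have "duct_flow \<gamma> a e xB I k (deriv_in I k) (case_prod S) Sx St (case_prod R) Rx Rt"
  proof (unfold_locales)
    fix p assume p: "p \<in> I \<times> {0::real..}" "fst p = xB \<or> snd p = 0"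
    then show "0 < case_prod S p \<and> case_prod S p < case_prod R p \<and>
        case_prod R p - case_prod S p \<le> e / 2 * case_prod S p \<and>
        a * k (fst p) * (case_prod S p)\<^sup>2 \<le> - St p \<and> Rt p \<le> 0"
      using init_data[of "fst p"] bdry_data[of "snd p"] by (cases p) auto
  qed (use gamma e I' k0 kd kle S R pde in \<open>auto simp: a_def\<close>)
  then show ?thesis by blast
qed

section \<open>The limit statements\<close>

lemma uniform_limit_zero_of_bound:
  fixes f :: "real \<Rightarrow> real \<Rightarrow> real"
  assumes "\<And>x t. x \<in> A \<Longrightarrow> 0 < t \<Longrightarrow> \<bar>f x t\<bar> \<le> B t" and B: "(B \<longlongrightarrow> 0) at_top"
  shows "uniform_limit A (\<lambda>t x. f x t) (\<lambda>_. 0) at_top"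
  unfolding uniform_limit_iff
proof (intro allI impI)
  fix \<epsilon> :: real assume "\<epsilon> > 0"
  show "\<forall>\<^sub>F t in at_top. \<forall>x\<in>A. dist (f x t) 0 < \<epsilon>"
    using order_tendstoD(2)[OF B \<open>\<epsilon> > 0\<close>] eventually_gt_at_top[of 0]
    by eventually_elim (use assms(1) in fastforce)
qed

text \<open>All quantities are dominated by a multiple of \<open>S\<close>: \<open>R\<close> and \<open>v\<close> by \<open>2 S\<close>, and \<open>\<rho>\<^bsup>(\<gamma> - 1) / 2\<^esup>\<close>
by a constant, depending on \<open>\<nu>\<close>, times \<open>R - S \<le> S\<close>.\<close>

lemma decay_conclusions:
  fixes S R :: "real \<Rightarrow> real \<Rightarrow> real" and A :: "real \<Rightarrow> real"
  defines "v \<equiv> \<lambda>x t. velocity (S x t) (R x t)"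
    and "\<rho> \<equiv> \<lambda>\<gamma> \<nu> x t. gas_density \<gamma> \<nu> (S x t) (R x t)"
  assumes gamma: "1 < \<gamma>" and \<nu>: "0 < \<nu>"
    and I: "\<And>x. x \<in> I \<Longrightarrow> xB \<le> x \<and> {xB..x} \<subseteq> I"
    and bounds: "\<And>x t. x \<in> I \<Longrightarrow> 0 \<le> t \<Longrightarrow> 0 < S x t \<and> S x t < R x t \<and> R x t \<le> 2 * S x t"
    and anti: "\<And>x s t. x \<in> I \<Longrightarrow> 0 \<le> s \<Longrightarrow> s \<le> t \<Longrightarrow> S x t \<le> S x s \<and> R x t \<le> R x s"
    and decay: "\<And>x x1 t. x1 \<in> I \<Longrightarrow> 0 < k x1 \<Longrightarrow> xB \<le> x \<Longrightarrow> x \<le> x1 \<Longrightarrow> 0 < t \<Longrightarrow> S x t \<le> A x1 / t"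
  shows "(\<forall>x\<in>I. k x > 0 \<longrightarrow>
           (\<forall>f\<in>{S, R, v}. antimono_on {0..} (f x) \<and> (f x \<longlongrightarrow> 0) at_top) \<and>
           (\<rho> \<gamma> \<nu> x \<longlongrightarrow> 0) at_top \<and>
           (\<forall>f\<in>{S, R, v, \<lambda>x t. \<rho> \<gamma> \<nu> x t powr ((\<gamma> - 1) / 2)}. f x \<in> O(\<lambda>t. 1 / t))) \<and>
        (\<forall>x1\<in>I. k x1 > 0 \<longrightarrow>
           (\<forall>f\<in>{S, R, v, \<rho> \<gamma> \<nu>}. uniform_limit {xB..x1} (\<lambda>t x. f x t) (\<lambda>_. 0) at_top) \<and>
           (\<forall>f\<in>{S, R, v, \<lambda>x t. \<rho> \<gamma> \<nu> x t powr ((\<gamma> - 1) / 2)}.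
              \<exists>C. \<forall>\<^sub>F t in at_top. \<forall>x\<in>{xB..x1}. \<bar>f x t\<bar> \<le> C / t))"
proof -
  define \<Gamma> where "\<Gamma> = ((\<gamma> - 1) / (16 * \<nu>)) powr (1 / (\<gamma> - 1))"
  define p where "p = 2 / (\<gamma> - 1)"
  have p: "0 < p" and pq: "p * ((\<gamma> - 1) / 2) = 1" using gamma by (simp_all add: p_def)
  have \<Gamma>: "0 \<le> \<Gamma>" by (simp add: \<Gamma>_def)
  have \<rho>: "\<rho> \<gamma> \<nu> x t = \<Gamma> * (R x t - S x t) powr p" for x t
    by (simp add: \<rho>_def gas_density_def \<Gamma>_def p_def)
  let ?P = "\<lambda>x t. \<rho> \<gamma> \<nu> x t powr ((\<gamma> - 1) / 2)"
  have bound: "\<exists>C. \<forall>x t. x \<in> {xB..x1} \<longrightarrow> 0 < t \<longrightarrow> \<bar>f x t\<bar> \<le> C / t"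
    if "x1 \<in> I" "0 < k x1" "f \<in> {S, R, v, ?P}" for x1 f
  proof -
    let ?q = "\<Gamma> powr ((\<gamma> - 1) / 2)"
    have "\<bar>f x t\<bar> \<le> (2 + ?q) * A x1 / t" if x: "x \<in> {xB..x1}" and t: "0 < t" for x t
    proof -
      have xI: "x \<in> I" using x I[OF \<open>x1 \<in> I\<close>] by auto
      note b = bounds[OF xI less_imp_le[OF t]]
      have d: "S x t \<le> A x1 / t" using decay \<open>x1 \<in> I\<close> \<open>0 < k x1\<close> x t by simp
      have pow: "?P x t = ?q * (R x t - S x t)"
        using b \<Gamma> pq by (simp add: \<rho> powr_mult powr_powr)
      have q: "0 \<le> ?q * S x t" "0 \<le> ?q * (R x t - S x t)" using b by simp_all
      have q': "?q * (R x t - S x t) \<le> ?q * S x t" using b by (intro mult_left_mono) auto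
      from \<open>f \<in> _\<close> consider "f = S" | "f = R" | "f = v" | "f = ?P" by auto
      then have "\<bar>f x t\<bar> \<le> 2 * S x t \<or> f x t = ?q * (R x t - S x t)"
        using b pow by cases (auto simp: v_def velocity_def)
      then have "\<bar>f x t\<bar> \<le> 2 * S x t + ?q * S x t"
        using b q q' by linarith
      also have "\<dots> = (2 + ?q) * S x t" by (simp add: algebra_simps)
      also have "\<dots> \<le> (2 + ?q) * (A x1 / t)" using d by (intro mult_left_mono) auto
      finally show ?thesis by simp
    qed
    then show ?thesis by blast
  qed
  have inv: "((\<lambda>t. C / t) \<longlongrightarrow> 0) at_top" for C :: real
    by (intro tendsto_divide_0[OF tendsto_const] filterlim_at_top_imp_at_infinity filterlim_ident)
  have uni: "uniform_limit {xB..x1} (\<lambda>t x. f x t) (\<lambda>_. 0) at_top"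
    if "x1 \<in> I" "0 < k x1" "f \<in> {S, R, v, \<rho> \<gamma> \<nu>}" for x1 f
  proof (cases "f \<in> {S, R, v}")
    case True
    then have "f \<in> {S, R, v, ?P}" by blast
    from bound[OF that(1,2) this] obtain C
      where "\<forall>x t. x \<in> {xB..x1} \<longrightarrow> 0 < t \<longrightarrow> \<bar>f x t\<bar> \<le> C / t"
      by blast
    then show ?thesis by (intro uniform_limit_zero_of_bound[OF _ inv[of C]]) auto
  next
    case False
    then have f: "f = \<rho> \<gamma> \<nu>" using that by auto
    show ?thesis unfolding f
    proof (rule uniform_limit_zero_of_bound)
      fix x t assume x: "x \<in> {xB..x1}" and t: "0 < (t::real)"
      have xI: "x \<in> I" using x I[OF \<open>x1 \<in> I\<close>] by auto
      note b = bounds[OF xI less_imp_le[OF t]]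
      have "R x t - S x t \<le> A x1 / t" using b decay[OF that(1,2), of x t] x t by auto
      then have "(R x t - S x t) powr p \<le> (A x1 / t) powr p" using b p by (intro powr_mono2) auto
      then show "\<bar>\<rho> \<gamma> \<nu> x t\<bar> \<le> \<Gamma> * (A x1 / t) powr p"
        using \<Gamma> by (simp add: \<rho> abs_mult mult_left_mono)
    next
      have "0 \<le> A x1"
        using decay[OF that(1,2), of x1 1] bounds[OF that(1), of 1] I[OF that(1)] by auto
      then have "((\<lambda>t. (A x1 / t) powr p) \<longlongrightarrow> 0) at_top"
        using p by (intro tendsto_zero_powrI[OF inv tendsto_const])
          (auto intro: eventually_mono[OF eventually_gt_at_top[of 0]])
      then show "((\<lambda>t. \<Gamma> * (A x1 / t) powr p) \<longlongrightarrow> 0) at_top" by (rule tendsto_mult_right_zero)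
    qed
  qed
  have lim: "(f x \<longlongrightarrow> 0) at_top" if "x \<in> I" "0 < k x" "f \<in> {S, R, v, \<rho> \<gamma> \<nu>}" for x f
    using tendsto_uniform_limitI[OF uni[OF that], of x] I[OF that(1)] by simp
  have bigo: "f x \<in> O(\<lambda>t. 1 / t)" if "x \<in> I" "0 < k x" "f \<in> {S, R, v, ?P}" for x f
  proof -
    from bound[OF that] obtain C where C: "\<And>y t. y \<in> {xB..x} \<Longrightarrow> 0 < t \<Longrightarrow> \<bar>f y t\<bar> \<le> C / t"
      by blast
    show ?thesis
      by (rule bigoI[of _ C], rule eventually_mono[OF eventually_gt_at_top[of 0]])
        (use C[of x] I[OF that(1)] in auto)
  qed
  have ev: "\<exists>C. \<forall>\<^sub>F t in at_top. \<forall>x\<in>{xB..x1}. \<bar>f x t\<bar> \<le> C / t"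
    if "x1 \<in> I" "0 < k x1" "f \<in> {S, R, v, ?P}" for x1 f
  proof -
    from bound[OF that] obtain C where C: "\<And>x t. x \<in> {xB..x1} \<Longrightarrow> 0 < t \<Longrightarrow> \<bar>f x t\<bar> \<le> C / t"
      by blast
    have "\<forall>\<^sub>F t in at_top. \<forall>x\<in>{xB..x1}. \<bar>f x t\<bar> \<le> C / t"
      using eventually_gt_at_top[of "0::real"] by eventually_elim (use C in blast)
    then show ?thesis by blast
  qed
  have mono: "antimono_on {0..} (f x)" if "x \<in> I" "f \<in> {S, R, v}" for x f
  proof (rule monotone_onI)
    fix s t :: real assume "s \<in> {0..}" "t \<in> {0..}" "s \<le> t"
    then show "f x t \<le> f x s"
      using anti[OF that(1), of s t] that(2) by (auto simp: v_def velocity_def)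
  qed
  show ?thesis
  proof (intro conjI ballI impI)
    fix x assume x: "x \<in> I" "0 < k x"
    show "antimono_on {0..} (f x)" "(f x \<longlongrightarrow> 0) at_top" if "f \<in> {S, R, v}" for f
      using mono[OF x(1) that] lim[OF x, of f] that by auto
    show "(\<rho> \<gamma> \<nu> x \<longlongrightarrow> 0) at_top" by (rule lim[OF x]) simp
  qed (rule bigo uni ev; assumption)+
qed

theorem proposition3p8:
  fixes \<gamma> \<delta> xB :: real
    and I :: "real set"
    and k :: "real \<Rightarrow> real"
    and S0 R0 SB RB :: "real \<Rightarrow> real \<Rightarrow> real"  \<comment> \<open>first argument: \<open>\<nu>\<close>\<close>
  assumes "1 < \<gamma>" "\<gamma> < 3"
    and "(\<exists>xC>xB. I = {xB..xC}) \<or> I = {xB..}"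
    and "cond_A1 I k"
    and "0 < \<delta>" "\<delta> < 2"
    and "\<forall>x\<in>I. deriv_in I k x \<le> (k x)\<^sup>2 / ((2 - \<delta>) * b_const \<gamma>)"
    and "\<forall>\<^sub>F \<nu> in at_right 0. cond_A2 \<gamma> I xB k (S0 \<nu>) (R0 \<nu>) (SB \<nu>) (RB \<nu>)"
    and "\<exists>M. \<forall>\<^sub>F \<nu> in at_right 0. cond_A34 I M (S0 \<nu>) (R0 \<nu>)"
    and "\<exists>M. \<forall>\<^sub>F \<nu> in at_right 0. cond_A34 {0..} M (SB \<nu>) (RB \<nu>)"
    and "\<exists>C. \<forall>\<^sub>F \<nu> in at_right 0. cond_A5 I C \<nu> (S0 \<nu>) (R0 \<nu>) (SB \<nu>) (RB \<nu>)"
    and "\<forall>\<^sub>F \<nu> in at_right 0. cond_initial \<gamma> I k (S0 \<nu>) (R0 \<nu>)"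
    and "\<forall>\<^sub>F \<nu> in at_right 0. cond_boundary \<gamma> xB k (SB \<nu>) (RB \<nu>)"
  shows "\<exists>\<nu>1>0. \<forall>\<nu>. 0 < \<nu> \<and> \<nu> \<le> \<nu>1 \<longrightarrow>
    (\<forall>S R. global_C1_solution \<gamma> I xB k (S0 \<nu>) (R0 \<nu>) (SB \<nu>) (RB \<nu>) S R \<longrightarrow>
      (let v = (\<lambda>x t. velocity (S x t) (R x t));
           \<rho> = (\<lambda>x t. gas_density \<gamma> \<nu> (S x t) (R x t))
       in
        (\<forall>x\<in>I. k x > 0 \<longrightarrow>
           (\<forall>f\<in>{S, R, v}. antimono_on {0..} (f x) \<and> (f x \<longlongrightarrow> 0) at_top) \<and>
           (\<rho> x \<longlongrightarrow> 0) at_top \<and>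
           (\<forall>f\<in>{S, R, v, \<lambda>x t. \<rho> x t powr ((\<gamma> - 1) / 2)}. f x \<in> O(\<lambda>t. 1 / t))) \<and>
        (\<forall>x1\<in>I. k x1 > 0 \<longrightarrow>
           (\<forall>f\<in>{S, R, v, \<rho>}. uniform_limit {xB..x1} (\<lambda>t x. f x t) (\<lambda>_. 0) at_top) \<and>
           (\<forall>f\<in>{S, R, v, \<lambda>x t. \<rho> x t powr ((\<gamma> - 1) / 2)}.
              \<exists>C. \<forall>\<^sub>F t in at_top. \<forall>x\<in>{xB..x1}. \<bar>f x t\<bar> \<le> C / t))))"
proof -
  define a where "a = (\<gamma> - 1) / (2 * (3 - \<gamma>))"
  define b where "b = b_const \<gamma>"
  define c where "c = 1 / (b + 1)"
  define d where "d = (if b = -1 then 1 / 6 else (1 - b) / (2 * (b + 1) * (1 - 2 * b)))"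
  have a: "0 < a" using assms(1,2) by (simp add: a_def)
  have g2: "1 < \<gamma>\<^sup>2" using assms(1) by (simp add: one_less_power)
  \<comment> \<open>The bound for \<open>(R - S) / S\<close> that the evolution has to respect.\<close>
  define e where "e = min 1 (min a ((\<gamma>\<^sup>2 - 1) / (24 * (3 - \<gamma>))))"
  have "0 < (\<gamma>\<^sup>2 - 1) / (24 * (3 - \<gamma>))" using assms(1,2) g2 by simp
  then have e: "0 < e" "e \<le> 1" "e \<le> a" "e \<le> (\<gamma>\<^sup>2 - 1) / (24 * (3 - \<gamma>))"
    using a by (auto simp: e_def)
  from e(4) have e4: "24 * (3 - \<gamma>) * e \<le> \<gamma>\<^sup>2 - 1"
    using assms(1,2) by (simp add: pos_le_divide_eq mult.commute)
  obtain M0 MB C where M: "\<forall>\<^sub>F \<nu> in at_right 0. cond_A34 I M0 (S0 \<nu>) (R0 \<nu>)"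
      "\<forall>\<^sub>F \<nu> in at_right 0. cond_A34 {0..} MB (SB \<nu>) (RB \<nu>)"
      "\<forall>\<^sub>F \<nu> in at_right 0. cond_A5 I C \<nu> (S0 \<nu>) (R0 \<nu>) (SB \<nu>) (RB \<nu>)"
    using assms(9-11) by blast
  \<comment> \<open>The bound for \<open>\<xi>\<close> on the data.  Its last part makes \<open>S \<xi> \<le> 1\<close>, so that \<open>\<epsilon> \<le> 0\<close>.\<close>
  define z where "z = min (min (e / 2) (a / (\<bar>c\<bar> + \<bar>d\<bar> + 1))) (1 / (\<bar>M0\<bar> + \<bar>MB\<bar> + 1))"
  have z: "0 < z" "z \<le> e / 2" "z \<le> a / (\<bar>c\<bar> + \<bar>d\<bar> + 1)" "z \<le> 1 / (\<bar>M0\<bar> + \<bar>MB\<bar> + 1)"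
  proof -
    show "0 < z" using e a by (auto simp: z_def intro!: divide_pos_pos)
  qed (unfold z_def, linarith+)
  have z2: "z * (\<bar>c\<bar> + \<bar>d\<bar> + 1) \<le> a" using z(3) by (subst (asm) pos_le_divide_eq) auto
  have z3: "m * z \<le> 1" if "m \<le> \<bar>M0\<bar> + \<bar>MB\<bar> + 1" for m
  proof -
    have "m * z \<le> (\<bar>M0\<bar> + \<bar>MB\<bar> + 1) * z" using that z by (intro mult_right_mono) auto
    also have "\<dots> = z * (\<bar>M0\<bar> + \<bar>MB\<bar> + 1)" by (rule mult.commute)
    also have "\<dots> \<le> 1" using z(4) by (subst (asm) pos_le_divide_eq) auto
    finally show ?thesis .
  qed
  have "((\<lambda>\<nu>. C * sqrt \<nu>) \<longlongrightarrow> C * sqrt 0) (at_right 0)"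
    by (intro tendsto_intros)
  then have "\<forall>\<^sub>F \<nu> in at_right 0. C * sqrt \<nu> < z" using order_tendstoD(2) z(1) by fastforce
  with M assms(12,13) have "\<forall>\<^sub>F \<nu> in at_right 0. cond_A34 I M0 (S0 \<nu>) (R0 \<nu>) \<and>
      cond_A34 {0..} MB (SB \<nu>) (RB \<nu>) \<and> cond_A5 I C \<nu> (S0 \<nu>) (R0 \<nu>) (SB \<nu>) (RB \<nu>) \<and>
      cond_initial \<gamma> I k (S0 \<nu>) (R0 \<nu>) \<and> cond_boundary \<gamma> xB k (SB \<nu>) (RB \<nu>) \<and> C * sqrt \<nu> < z"
    by (simp add: eventually_conj)
  then obtain \<nu>0 where "0 < \<nu>0" and ok: "\<And>\<nu>. 0 < \<nu> \<Longrightarrow> \<nu> < \<nu>0 \<Longrightarrow> cond_A34 I M0 (S0 \<nu>) (R0 \<nu>) \<and>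
      cond_A34 {0..} MB (SB \<nu>) (RB \<nu>) \<and> cond_A5 I C \<nu> (S0 \<nu>) (R0 \<nu>) (SB \<nu>) (RB \<nu>) \<and>
      cond_initial \<gamma> I k (S0 \<nu>) (R0 \<nu>) \<and> cond_boundary \<gamma> xB k (SB \<nu>) (RB \<nu>) \<and> C * sqrt \<nu> < z"
    unfolding eventually_at_right_field by blast
  show ?thesis
  proof (intro exI[of _ "\<nu>0 / 2"] conjI allI impI)
    fix \<nu> S R
    assume "0 < \<nu> \<and> \<nu> \<le> \<nu>0 / 2" and sol: "global_C1_solution \<gamma> I xB k (S0 \<nu>) (R0 \<nu>) (SB \<nu>) (RB \<nu>) S R"
    then have \<nu>: "0 < \<nu>" "\<nu> < \<nu>0" using \<open>0 < \<nu>0\<close> by auto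
    note ok' = ok[OF \<nu>]
    obtain Sx St Rx Rt where
      flow: "duct_flow \<gamma> a e xB I k (deriv_in I k) (case_prod S) Sx St (case_prod R) Rx Rt"
      using duct_flow_of_solution[OF a_def c_def[unfolded b_def] d_def[unfolded b_def] assms(1-7), where e = e and z = z and ?M0.0 = M0 and MB = MB and C = C and \<nu> = \<nu>
          and ?s0.0 = "S0 \<nu>" and ?r0.0 = "R0 \<nu>" and sB = "SB \<nu>" and rB = "RB \<nu>" and S = S and R = R]
        e e4 z2 z(2) z3[of M0] z3[of MB] ok' sol
      by fastforce
    interpret duct_flow \<gamma> a e xB I k "deriv_in I k" "case_prod S" Sx St "case_prod R" Rx Rt by (rule flow)
    have dec: "S x t \<le> 1 / (a * k x1) / t"
      if "x1 \<in> I" "0 < k x1" "xB \<le> x" "x \<le> x1" "0 < t" for x x1 t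
    proof -
      have x: "x \<in> I" using I[OF that(1)] that by auto
      have "a * k x1 * t * S x t \<le> a * k x * t * S x t"
        using k_antimono[OF that(1,3,4)] \<open>0 < a\<close> that solution_bounds(1)[of "(x, t)"] x
        by (intro mult_right_mono mult_left_mono) (auto intro: less_imp_le)
      also have "\<dots> \<le> 1" using S_decay[OF x, of t] that by simp
      finally show ?thesis using that \<open>0 < a\<close> by (simp add: field_simps)
    qed
    show "let v = \<lambda>x t. velocity (S x t) (R x t); \<rho> = \<lambda>x t. gas_density \<gamma> \<nu> (S x t) (R x t)
       in
        (\<forall>x\<in>I. k x > 0 \<longrightarrow>
           (\<forall>f\<in>{S, R, v}. antimono_on {0..} (f x) \<and> (f x \<longlongrightarrow> 0) at_top) \<and>
           (\<rho> x \<longlongrightarrow> 0) at_top \<and>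
           (\<forall>f\<in>{S, R, v, \<lambda>x t. \<rho> x t powr ((\<gamma> - 1) / 2)}. f x \<in> O(\<lambda>t. 1 / t))) \<and>
        (\<forall>x1\<in>I. k x1 > 0 \<longrightarrow>
           (\<forall>f\<in>{S, R, v, \<rho>}. uniform_limit {xB..x1} (\<lambda>t x. f x t) (\<lambda>_. 0) at_top) \<and>
           (\<forall>f\<in>{S, R, v, \<lambda>x t. \<rho> x t powr ((\<gamma> - 1) / 2)}.
              \<exists>C. \<forall>\<^sub>F t in at_top. \<forall>x\<in>{xB..x1}. \<bar>f x t\<bar> \<le> C / t))"
      unfolding Let_def
    proof (rule decay_conclusions[where A = "\<lambda>x1. 1 / (a * k x1)"])
      show "0 < S x t \<and> S x t < R x t \<and> R x t \<le> 2 * S x t" if "x \<in> I" "0 \<le> t" for x t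
        using solution_bounds(1-3)[of "(x, t)"] that by auto
      show "S x t \<le> S x s \<and> R x t \<le> R x s" if "x \<in> I" "0 \<le> s" "s \<le> t" for x s t
        using S_antimono[OF that] R_antimono[OF that] by simp
    qed (use I dec assms(1) \<nu> in auto)
  qed (use \<open>0 < \<nu>0\<close> in simp)
qed

end
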